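(* Let $(\mathscr{D},\Psi)$ be a geometrized elliptic Monge–Ampère equation (GEMA), where $\mathscr{D}$ is a domain (resp. a manifold, i.e. $(\mathscr{D},\Psi)$ is a Monge–Ampère manifold). Let $\nabla^0$ be its flat torsion-free affine connection, and let $g$ and $A$ be given in flat coordinates by $g_{ij}=\partial_i\partial_j\Psi$ and $A_{ijk}=\partial_i\partial_j\partial_k\Psi$. Then the quintuple $(\mathscr{D},\Psi,g,A,\nabla^0)$ is a potential pre-Frobenius domain (resp. manifold).
   Context: A GEMA $(\mathscr{D},\Psi)$ consists of a domain $\mathscr{D}\subset\mathbb{R}^n$ with its standard flat affine structure (flat torsion-free connection $\nabla^0$, the usual directional derivative) and a smooth real strictly convex function $\Psi$ solving an elliptic Monge–Ampère equation $\det\mathrm{Hess}(\Psi)=f$ with $f>0$. When $\mathscr{D}$ is a manifold with a flat affine structure and these conditions are read in local flat coordinates, $(\mathscr{D},\Psi)$ is called a Monge–Ampère manifold. A potential pre-Frobenius manifold (or domain, if the underlying manifold is a domain) $M$ consists of: (i) an affine flat structure on $M$, i.e. a flat torsion-free connection $\nabla^0$; (ii) a non-degenerate symmetric bilinear form $g$ on the tangent sheaf $\mathcal{T}_M$ compatible with $\nabla^0$ in the sense that $\nabla^0 g$ is symmetric; (iii) a symmetric rank three tensor $A$ such that in local flat coordinates $(x^a)$, $A_{abc}=\partial_a\partial_b\partial_c\Psi$, where $\partial_a=\partial/\partial x^a$ and $\Psi$ is some smooth potential function; (iv) a bilinear multiplication $\circ:\mathcal{T}_M\times\mathcal{T}_M\to\mathcal{T}_M$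 given by $\partial_a\circ\partial_b=\sum_c A_{ab}^c\,\partial_c$ with $A_{ab}^c=\sum_e A_{abe}g^{ec}$, where $(g^{ec})$ is the inverse matrix of $(g_{ec})$; (v) the compatibility $A(X,Y,Z)=g(X\circ Y,Z)=g(X,Y\circ Z)$ for flat vector fields $X,Y,Z$. In the quintuple, the multiplication $\circ$ is the one determined by $g$ and $A$ through (iv). *)

theory Defs
  imports "HOL-Analysis.Analysis"
begin

section \<open>Calculus on open subsets of Euclidean space\<close>

definition partial :: "'n \<Rightarrow> (real^'n \<Rightarrow> 'b::real_normed_vector) \<Rightarrow> real^'n \<Rightarrow> 'b" where
  "partial i f x = frechet_derivative f (at x) (axis i 1)"

text \<open>Smoothness on an open set: every iterated partial derivative is (Frechet) differentiable there.
  Differentiability of all of them makes all of them continuous, so this is the usual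
  class of infinitely differentiable functions.\<close>

definition smooth_on :: "(real^'n) set \<Rightarrow> (real^'n \<Rightarrow> 'b::real_normed_vector) \<Rightarrow> bool" where
  "smooth_on S f \<longleftrightarrow> (\<forall>ks. \<forall>x\<in>S. foldr partial ks f differentiable (at x))"

definition hessian :: "(real^'n \<Rightarrow> real) \<Rightarrow> real^'n \<Rightarrow> real^'n^'n" where
  "hessian f x = (\<chi> i j. partial i (partial j f) x)"

text \<open>The set is not assumed to be convex; strict convexity is required along every segment
  contained in it.\<close>

definition strictly_convex_on :: "(real^'n) set \<Rightarrow> (real^'n \<Rightarrow> real) \<Rightarrow> bool" where
  "strictly_convex_on S f \<longleftrightarrow>
     (\<forall>x y t. closed_segment x y \<subseteq> S \<and> x \<noteq> y \<and> 0 < t \<and> t < 1 \<longrightarrow>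
        f ((1 - t) *\<^sub>R x + t *\<^sub>R y) < (1 - t) * f x + t * f y)"

definition monge_ampere_potential :: "(real^'n) set \<Rightarrow> (real^'n \<Rightarrow> real) \<Rightarrow> bool" where
  "monge_ampere_potential S \<Psi> \<longleftrightarrow>
     smooth_on S \<Psi> \<and> strictly_convex_on S \<Psi> \<and>
     (\<exists>f. \<forall>x\<in>S. f x > 0 \<and> det (hessian \<Psi> x) = f x)"


section \<open>Manifolds with a flat affine structure\<close>

text \<open>A chart consists of its domain and its coordinate map; values of the map outside the
  domain are irrelevant.\<close>

type_synonym ('a, 'n) chart = "'a set \<times> ('a \<Rightarrow> real^'n)"

abbreviation chart_dom :: "('a, 'n::finite) chart \<Rightarrow> 'a set" where
  "chart_dom c \<equiv> fst c"

abbreviation coord :: "('a, 'n::finite) chart \<Rightarrow> 'a \<Rightarrow> real^'n" where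
  "coord c \<equiv> snd c"

definition local_rep :: "('a, 'n::finite) chart \<Rightarrow> ('a \<Rightarrow> 'b) \<Rightarrow> real^'n \<Rightarrow> 'b" where
  "local_rep c F = (\<lambda>x. F (inv_into (chart_dom c) (coord c) x))"

definition is_chart :: "'a topology \<Rightarrow> ('a, 'n::finite) chart \<Rightarrow> bool" where
  "is_chart T c \<longleftrightarrow>
     openin T (chart_dom c) \<and> open (coord c ` chart_dom c) \<and>
     homeomorphic_map (subtopology T (chart_dom c)) (top_of_set (coord c ` chart_dom c)) (coord c)"

definition affinely_compatible ::
    "'a topology \<Rightarrow> ('a, 'n::finite) chart \<Rightarrow> ('a, 'n) chart \<Rightarrow> bool" where
  "affinely_compatible T c d \<longleftrightarrow>
     (\<forall>p \<in> chart_dom c \<inter> chart_dom d. \<exists>W L b.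
        openin T W \<and> p \<in> W \<and> W \<subseteq> chart_dom c \<inter> chart_dom d \<and>
        invertible L \<and> (\<forall>q\<in>W. coord d q = L *v coord c q + b))"

record ('a, 'n) affine_structure =
  mtop :: "'a topology"
  matlas :: "('a, 'n) chart set"

definition affine_manifold :: "('a, 'n::finite) affine_structure \<Rightarrow> bool" where
  "affine_manifold M \<longleftrightarrow>
     Hausdorff_space (mtop M) \<and> second_countable (mtop M) \<and>
     (\<forall>c\<in>matlas M. is_chart (mtop M) c) \<and>
     (\<Union>c\<in>matlas M. chart_dom c) = topspace (mtop M) \<and>
     (\<forall>c\<in>matlas M. \<forall>d\<in>matlas M. affinely_compatible (mtop M) c d)"

text \<open>The local flat coordinate systems: the maximal affine atlas generated by the given one.\<close>

definition flat_charts :: "('a, 'n::finite) affine_structure \<Rightarrow> ('a, 'n) chart set" where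
  "flat_charts M =
     {c. is_chart (mtop M) c \<and> (\<forall>d\<in>matlas M. affinely_compatible (mtop M) c d)}"

definition is_domain :: "(real^'n) set \<Rightarrow> bool" where
  "is_domain D \<longleftrightarrow> open D \<and> connected D \<and> D \<noteq> {}"

definition standard_affine :: "(real^'n) set \<Rightarrow> (real^'n, 'n) affine_structure" where
  "standard_affine D = \<lparr>mtop = top_of_set D, matlas = {(D, \<lambda>x. x)}\<rparr>"

definition GEMA :: "(real^'n) set \<Rightarrow> (real^'n \<Rightarrow> real) \<Rightarrow> bool" where
  "GEMA D \<Psi> \<longleftrightarrow> is_domain D \<and> monge_ampere_potential D \<Psi>"

definition Monge_Ampere_manifold ::
    "('a, 'n::finite) affine_structure \<Rightarrow> ('a \<Rightarrow> real) \<Rightarrow> bool" where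
  "Monge_Ampere_manifold M \<Psi> \<longleftrightarrow>
     affine_manifold M \<and>
     (\<forall>c\<in>flat_charts M. monge_ampere_potential (coord c ` chart_dom c) (local_rep c \<Psi>))"


section \<open>Functions, vector fields and tensors\<close>

text \<open>Vector fields and tensors are given by their components with respect to the flat
  charts, subject to the usual transformation law. Components are meaningful only for flat charts
  \<open>c\<close> and points of the domain of \<open>c\<close>; all conditions below are restricted accordingly.\<close>

type_synonym ('a, 'n) vfield = "('a, 'n) chart \<Rightarrow> 'a \<Rightarrow> real^'n"
type_synonym ('a, 'n) tensor2 = "('a, 'n) chart \<Rightarrow> 'a \<Rightarrow> real^'n^'n"
type_synonym ('a, 'n) tensor3 = "('a, 'n) chart \<Rightarrow> 'a \<Rightarrow> real^'n^'n^'n"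

definition smooth_in_charts :: "('a, 'n::finite) affine_structure \<Rightarrow> 'a set \<Rightarrow>
    (('a, 'n) chart \<Rightarrow> 'a \<Rightarrow> 'b::real_normed_vector) \<Rightarrow> bool" where
  "smooth_in_charts M U F \<longleftrightarrow>
     (\<forall>c\<in>flat_charts M. smooth_on (coord c ` (U \<inter> chart_dom c)) (local_rep c (F c)))"

definition smooth_fun :: "('a, 'n::finite) affine_structure \<Rightarrow> 'a set \<Rightarrow> ('a \<Rightarrow> real) \<Rightarrow> bool" where
  "smooth_fun M U f \<longleftrightarrow> smooth_in_charts M U (\<lambda>c. f)"

definition transition_jacobian ::
    "('a, 'n::finite) chart \<Rightarrow> ('a, 'n) chart \<Rightarrow> 'a \<Rightarrow> real^'n^'n" where
  "transition_jacobian c d p = jacobian (local_rep c (coord d)) (at (coord c p))"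

definition vector_field_on ::
    "('a, 'n::finite) affine_structure \<Rightarrow> 'a set \<Rightarrow> ('a, 'n) vfield \<Rightarrow> bool" where
  "vector_field_on M U X \<longleftrightarrow>
     smooth_in_charts M U X \<and>
     (\<forall>c\<in>flat_charts M. \<forall>d\<in>flat_charts M. \<forall>p \<in> U \<inter> chart_dom c \<inter> chart_dom d.
        X d p = transition_jacobian c d p *v X c p)"

definition eq_field_on :: "('a, 'n::finite) affine_structure \<Rightarrow> 'a set \<Rightarrow>
    ('a, 'n) vfield \<Rightarrow> ('a, 'n) vfield \<Rightarrow> bool" where
  "eq_field_on M U X Y \<longleftrightarrow> (\<forall>c\<in>flat_charts M. \<forall>p \<in> U \<inter> chart_dom c. X c p = Y c p)"

abbreviation field_zero :: "('a, 'n::finite) vfield" where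
  "field_zero \<equiv> (\<lambda>c p. 0)"

abbreviation field_add :: "('a, 'n::finite) vfield \<Rightarrow> ('a, 'n) vfield \<Rightarrow> ('a, 'n) vfield" where
  "field_add X Y \<equiv> (\<lambda>c p. X c p + Y c p)"

abbreviation field_diff :: "('a, 'n::finite) vfield \<Rightarrow> ('a, 'n) vfield \<Rightarrow> ('a, 'n) vfield" where
  "field_diff X Y \<equiv> (\<lambda>c p. X c p - Y c p)"

abbreviation field_scale :: "('a \<Rightarrow> real) \<Rightarrow> ('a, 'n::finite) vfield \<Rightarrow> ('a, 'n) vfield" where
  "field_scale f X \<equiv> (\<lambda>c p. f p *\<^sub>R X c p)"

text \<open>The coordinate field of index \<open>a\<close> of the chart \<open>c\<close>, a vector field on the domain of \<open>c\<close>.\<close>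

definition coord_field :: "('a, 'n::finite) chart \<Rightarrow> 'n \<Rightarrow> ('a, 'n) vfield" where
  "coord_field c a = (\<lambda>d p. transition_jacobian c d p *v axis a 1)"

definition tensor2_on_manifold ::
    "('a, 'n::finite) affine_structure \<Rightarrow> ('a, 'n) tensor2 \<Rightarrow> bool" where
  "tensor2_on_manifold M g \<longleftrightarrow>
     smooth_in_charts M (topspace (mtop M)) g \<and>
     (\<forall>c\<in>flat_charts M. \<forall>d\<in>flat_charts M. \<forall>p \<in> chart_dom c \<inter> chart_dom d. \<forall>a b.
        g c p $ a $ b =
          (\<Sum>i\<in>UNIV. \<Sum>j\<in>UNIV. transition_jacobian c d p $ i $ a * transition_jacobian c d p $ j $ b
             * g d p $ i $ j))"

definition tensor3_on_manifold ::
    "('a, 'n::finite) affine_structure \<Rightarrow> ('a, 'n) tensor3 \<Rightarrow> bool" where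
  "tensor3_on_manifold M A \<longleftrightarrow>
     smooth_in_charts M (topspace (mtop M)) A \<and>
     (\<forall>c\<in>flat_charts M. \<forall>d\<in>flat_charts M. \<forall>p \<in> chart_dom c \<inter> chart_dom d. \<forall>a b e.
        A c p $ a $ b $ e =
          (\<Sum>i\<in>UNIV. \<Sum>j\<in>UNIV. \<Sum>k\<in>UNIV.
             transition_jacobian c d p $ i $ a * transition_jacobian c d p $ j $ b
             * transition_jacobian c d p $ k $ e * A d p $ i $ j $ k))"

definition tensor2_eval :: "('a, 'n::finite) tensor2 \<Rightarrow> ('a, 'n) vfield \<Rightarrow> ('a, 'n) vfield \<Rightarrow>
    ('a, 'n) chart \<Rightarrow> 'a \<Rightarrow> real" where
  "tensor2_eval g X Y c p =
     (\<Sum>i\<in>UNIV. \<Sum>j\<in>UNIV. g c p $ i $ j * X c p $ i * Y c p $ j)"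

definition tensor3_eval :: "('a, 'n::finite) tensor3 \<Rightarrow> ('a, 'n) vfield \<Rightarrow> ('a, 'n) vfield \<Rightarrow>
    ('a, 'n) vfield \<Rightarrow> ('a, 'n) chart \<Rightarrow> 'a \<Rightarrow> real" where
  "tensor3_eval A X Y Z c p =
     (\<Sum>i\<in>UNIV. \<Sum>j\<in>UNIV. \<Sum>k\<in>UNIV. A c p $ i $ j $ k * X c p $ i * Y c p $ j * Z c p $ k)"


section \<open>Connections\<close>

definition dir_deriv :: "('a, 'n::finite) chart \<Rightarrow> ('a, 'n) vfield \<Rightarrow>
    ('a \<Rightarrow> 'b::real_normed_vector) \<Rightarrow> 'a \<Rightarrow> 'b" where
  "dir_deriv c X F p = frechet_derivative (local_rep c F) (at (coord c p)) (X c p)"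

definition lie_bracket :: "('a, 'n::finite) vfield \<Rightarrow> ('a, 'n) vfield \<Rightarrow> ('a, 'n) vfield" where
  "lie_bracket X Y = (\<lambda>c p. dir_deriv c X (Y c) p - dir_deriv c Y (X c) p)"

type_synonym ('a, 'n) conn = "('a, 'n) vfield \<Rightarrow> ('a, 'n) vfield \<Rightarrow> ('a, 'n) vfield"

text \<open>A connection acts on vector fields over arbitrary open sets. The second conjunct says that
  it commutes with restriction, so it is a map on the tangent sheaf.\<close>

definition connection_on :: "('a, 'n::finite) affine_structure \<Rightarrow> ('a, 'n) conn \<Rightarrow> bool" where
  "connection_on M nabla \<longleftrightarrow>
     (\<forall>U X Y. openin (mtop M) U \<and> vector_field_on M U X \<and> vector_field_on M U Y \<longrightarrow>
        vector_field_on M U (nabla X Y) \<and>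
        (\<forall>X' Y'. vector_field_on M U X' \<and> vector_field_on M U Y' \<and>
           eq_field_on M U X X' \<and> eq_field_on M U Y Y' \<longrightarrow>
           eq_field_on M U (nabla X Y) (nabla X' Y')) \<and>
        (\<forall>X'. vector_field_on M U X' \<longrightarrow>
           eq_field_on M U (nabla (field_add X X') Y) (field_add (nabla X Y) (nabla X' Y))) \<and>
        (\<forall>Y'. vector_field_on M U Y' \<longrightarrow>
           eq_field_on M U (nabla X (field_add Y Y')) (field_add (nabla X Y) (nabla X Y'))) \<and>
        (\<forall>f. smooth_fun M U f \<longrightarrow>
           eq_field_on M U (nabla (field_scale f X) Y) (field_scale f (nabla X Y)) \<and>
           eq_field_on M U (nabla X (field_scale f Y))
             (\<lambda>c p. dir_deriv c X f p *\<^sub>R Y c p + f p *\<^sub>R nabla X Y c p)))"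

definition torsion_free :: "('a, 'n::finite) affine_structure \<Rightarrow> ('a, 'n) conn \<Rightarrow> bool" where
  "torsion_free M nabla \<longleftrightarrow>
     (\<forall>U X Y. openin (mtop M) U \<and> vector_field_on M U X \<and> vector_field_on M U Y \<longrightarrow>
        eq_field_on M U (field_diff (nabla X Y) (nabla Y X)) (lie_bracket X Y))"

definition curvature_free :: "('a, 'n::finite) affine_structure \<Rightarrow> ('a, 'n) conn \<Rightarrow> bool" where
  "curvature_free M nabla \<longleftrightarrow>
     (\<forall>U X Y Z. openin (mtop M) U \<and> vector_field_on M U X \<and> vector_field_on M U Y \<and>
        vector_field_on M U Z \<longrightarrow>
        eq_field_on M U
          (field_diff (field_diff (nabla X (nabla Y Z)) (nabla Y (nabla X Z)))
             (nabla (lie_bracket X Y) Z))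
          field_zero)"

text \<open>A flat torsion-free connection whose flat coordinates are those of the affine structure.\<close>

definition affine_flat_connection ::
    "('a, 'n::finite) affine_structure \<Rightarrow> ('a, 'n) conn \<Rightarrow> bool" where
  "affine_flat_connection M nabla \<longleftrightarrow>
     connection_on M nabla \<and> torsion_free M nabla \<and> curvature_free M nabla \<and>
     (\<forall>c\<in>flat_charts M. \<forall>a b.
        eq_field_on M (chart_dom c) (nabla (coord_field c a) (coord_field c b)) field_zero)"

definition flat_field_on ::
    "('a, 'n::finite) affine_structure \<Rightarrow> ('a, 'n) conn \<Rightarrow> 'a set \<Rightarrow> ('a, 'n) vfield \<Rightarrow> bool" where
  "flat_field_on M nabla U X \<longleftrightarrow>
     vector_field_on M U X \<and>
     (\<forall>V W. openin (mtop M) V \<and> V \<subseteq> U \<and> vector_field_on M V W \<longrightarrow>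
        eq_field_on M V (nabla W X) field_zero)"

text \<open>The value of the covariant derivative of \<open>g\<close> along \<open>X\<close> on the pair \<open>Y\<close>, \<open>Z\<close>.\<close>

definition cov_deriv2 :: "('a, 'n::finite) conn \<Rightarrow> ('a, 'n) tensor2 \<Rightarrow> ('a, 'n) vfield \<Rightarrow>
    ('a, 'n) vfield \<Rightarrow> ('a, 'n) vfield \<Rightarrow> ('a, 'n) chart \<Rightarrow> 'a \<Rightarrow> real" where
  "cov_deriv2 nabla g X Y Z c p =
     dir_deriv c X (tensor2_eval g Y Z c) p
       - tensor2_eval g (nabla X Y) Z c p - tensor2_eval g Y (nabla X Z) c p"


section \<open>Potential pre-Frobenius manifolds\<close>

definition symmetric_tensor2 ::
    "('a, 'n::finite) affine_structure \<Rightarrow> ('a, 'n) tensor2 \<Rightarrow> bool" where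
  "symmetric_tensor2 M g \<longleftrightarrow>
     (\<forall>c\<in>flat_charts M. \<forall>p\<in>chart_dom c. \<forall>a b. g c p $ a $ b = g c p $ b $ a)"

definition nondegenerate_tensor2 ::
    "('a, 'n::finite) affine_structure \<Rightarrow> ('a, 'n) tensor2 \<Rightarrow> bool" where
  "nondegenerate_tensor2 M g \<longleftrightarrow>
     (\<forall>c\<in>flat_charts M. \<forall>p\<in>chart_dom c. \<forall>u.
        (\<forall>v. (\<Sum>i\<in>UNIV. \<Sum>j\<in>UNIV. g c p $ i $ j * u $ i * v $ j) = 0) \<longrightarrow> u = 0)"

definition cov_deriv_symmetric ::
    "('a, 'n::finite) affine_structure \<Rightarrow> ('a, 'n) conn \<Rightarrow> ('a, 'n) tensor2 \<Rightarrow> bool" where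
  "cov_deriv_symmetric M nabla g \<longleftrightarrow>
     (\<forall>U X Y Z. openin (mtop M) U \<and> vector_field_on M U X \<and> vector_field_on M U Y \<and>
        vector_field_on M U Z \<longrightarrow>
        (\<forall>c\<in>flat_charts M. \<forall>p \<in> U \<inter> chart_dom c.
           cov_deriv2 nabla g X Y Z c p = cov_deriv2 nabla g Y X Z c p \<and>
           cov_deriv2 nabla g X Y Z c p = cov_deriv2 nabla g X Z Y c p))"

definition symmetric_tensor3 ::
    "('a, 'n::finite) affine_structure \<Rightarrow> ('a, 'n) tensor3 \<Rightarrow> bool" where
  "symmetric_tensor3 M A \<longleftrightarrow>
     (\<forall>c\<in>flat_charts M. \<forall>p\<in>chart_dom c. \<forall>a b e.
        A c p $ a $ b $ e = A c p $ b $ a $ e \<and> A c p $ a $ b $ e = A c p $ a $ e $ b)"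

definition has_potential ::
    "('a, 'n::finite) affine_structure \<Rightarrow> ('a, 'n) tensor3 \<Rightarrow> ('a \<Rightarrow> real) \<Rightarrow> bool" where
  "has_potential M A \<Psi> \<longleftrightarrow>
     smooth_fun M (topspace (mtop M)) \<Psi> \<and>
     (\<forall>c\<in>flat_charts M. \<forall>p\<in>chart_dom c. \<forall>a b e.
        A c p $ a $ b $ e = partial a (partial b (partial e (local_rep c \<Psi>))) (coord c p))"

text \<open>The structure constants, with the last index of \<open>A\<close> raised by the inverse matrix of \<open>g\<close>.\<close>

definition structure_const :: "('a, 'n::finite) tensor2 \<Rightarrow> ('a, 'n) tensor3 \<Rightarrow>
    ('a, 'n) chart \<Rightarrow> 'a \<Rightarrow> 'n \<Rightarrow> 'n \<Rightarrow> 'n \<Rightarrow> real" where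
  "structure_const g A c p a b k =
     (\<Sum>e\<in>UNIV. A c p $ a $ b $ e * matrix_inv (g c p) $ e $ k)"

definition field_mult :: "('a, 'n::finite) tensor2 \<Rightarrow> ('a, 'n) tensor3 \<Rightarrow>
    ('a, 'n) vfield \<Rightarrow> ('a, 'n) vfield \<Rightarrow> ('a, 'n) vfield" where
  "field_mult g A X Y = (\<lambda>c p. \<chi> k.
     \<Sum>a\<in>UNIV. \<Sum>b\<in>UNIV. X c p $ a * Y c p $ b * structure_const g A c p a b k)"

definition bilinear_multiplication :: "('a, 'n::finite) affine_structure \<Rightarrow>
    (('a, 'n) vfield \<Rightarrow> ('a, 'n) vfield \<Rightarrow> ('a, 'n) vfield) \<Rightarrow> bool" where
  "bilinear_multiplication M m \<longleftrightarrow>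
     (\<forall>U X Y. openin (mtop M) U \<and> vector_field_on M U X \<and> vector_field_on M U Y \<longrightarrow>
        vector_field_on M U (m X Y) \<and>
        (\<forall>X' Y'. vector_field_on M U X' \<and> vector_field_on M U Y' \<and>
           eq_field_on M U X X' \<and> eq_field_on M U Y Y' \<longrightarrow> eq_field_on M U (m X Y) (m X' Y')) \<and>
        (\<forall>X'. vector_field_on M U X' \<longrightarrow>
           eq_field_on M U (m (field_add X X') Y) (field_add (m X Y) (m X' Y))) \<and>
        (\<forall>Y'. vector_field_on M U Y' \<longrightarrow>
           eq_field_on M U (m X (field_add Y Y')) (field_add (m X Y) (m X Y'))) \<and>
        (\<forall>f. smooth_fun M U f \<longrightarrow>
           eq_field_on M U (m (field_scale f X) Y) (field_scale f (m X Y)) \<and>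
           eq_field_on M U (m X (field_scale f Y)) (field_scale f (m X Y))))"

definition has_structure_constants :: "('a, 'n::finite) affine_structure \<Rightarrow> ('a, 'n) tensor2 \<Rightarrow>
    ('a, 'n) tensor3 \<Rightarrow> (('a, 'n) vfield \<Rightarrow> ('a, 'n) vfield \<Rightarrow> ('a, 'n) vfield) \<Rightarrow> bool" where
  "has_structure_constants M g A m \<longleftrightarrow>
     (\<forall>c\<in>flat_charts M. \<forall>a b.
        eq_field_on M (chart_dom c) (m (coord_field c a) (coord_field c b))
          (\<lambda>d p. \<Sum>k\<in>UNIV. structure_const g A c p a b k *\<^sub>R coord_field c k d p))"

definition mult_compatible :: "('a, 'n::finite) affine_structure \<Rightarrow> ('a, 'n) conn \<Rightarrow>
    ('a, 'n) tensor2 \<Rightarrow> ('a, 'n) tensor3 \<Rightarrow>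
    (('a, 'n) vfield \<Rightarrow> ('a, 'n) vfield \<Rightarrow> ('a, 'n) vfield) \<Rightarrow> bool" where
  "mult_compatible M nabla g A m \<longleftrightarrow>
     (\<forall>U X Y Z. openin (mtop M) U \<and> flat_field_on M nabla U X \<and> flat_field_on M nabla U Y \<and>
        flat_field_on M nabla U Z \<longrightarrow>
        (\<forall>c\<in>flat_charts M. \<forall>p \<in> U \<inter> chart_dom c.
           tensor3_eval A X Y Z c p = tensor2_eval g (m X Y) Z c p \<and>
           tensor2_eval g (m X Y) Z c p = tensor2_eval g X (m Y Z) c p))"

definition potential_pre_Frobenius_manifold :: "('a, 'n::finite) affine_structure \<Rightarrow>
    ('a \<Rightarrow> real) \<Rightarrow> ('a, 'n) tensor2 \<Rightarrow> ('a, 'n) tensor3 \<Rightarrow> ('a, 'n) conn \<Rightarrow> bool" where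
  "potential_pre_Frobenius_manifold M \<Psi> g A nabla \<longleftrightarrow>
     affine_manifold M \<and> affine_flat_connection M nabla \<and>
     tensor2_on_manifold M g \<and> symmetric_tensor2 M g \<and> nondegenerate_tensor2 M g \<and>
       cov_deriv_symmetric M nabla g \<and>
     tensor3_on_manifold M A \<and> symmetric_tensor3 M A \<and> has_potential M A \<Psi> \<and>
     bilinear_multiplication M (field_mult g A) \<and>
       has_structure_constants M g A (field_mult g A) \<and>
     mult_compatible M nabla g A (field_mult g A)"

definition potential_pre_Frobenius_domain :: "(real^'n, 'n) affine_structure \<Rightarrow>
    (real^'n \<Rightarrow> real) \<Rightarrow> (real^'n, 'n) tensor2 \<Rightarrow> (real^'n, 'n) tensor3 \<Rightarrow> (real^'n, 'n) conn \<Rightarrow> bool" where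
  "potential_pre_Frobenius_domain M \<Psi> g A nabla \<longleftrightarrow>
     potential_pre_Frobenius_manifold M \<Psi> g A nabla \<and>
     (\<exists>D. is_domain D \<and> mtop M = top_of_set D)"


section \<open>The data determined by a potential on an affine manifold\<close>

text \<open>In each flat chart: componentwise directional derivative, second and third partial
  derivatives of the local representative of the potential.\<close>

definition flat_connection :: "('a, 'n::finite) conn" where
  "flat_connection X Y = (\<lambda>c p. dir_deriv c X (Y c) p)"

definition hessian_metric :: "('a \<Rightarrow> real) \<Rightarrow> ('a, 'n::finite) tensor2" where
  "hessian_metric \<Psi> = (\<lambda>c p. \<chi> i j. partial i (partial j (local_rep c \<Psi>)) (coord c p))"

definition third_derivative_tensor :: "('a \<Rightarrow> real) \<Rightarrow> ('a, 'n::finite) tensor3" where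
  "third_derivative_tensor \<Psi> =
     (\<lambda>c p. \<chi> i j k. partial i (partial j (partial k (local_rep c \<Psi>))) (coord c p))"

end

theory Submission
  imports Defs
begin

text \<open>Two flat charts differ, near each common point, by an affine change of coordinates
  \<open>x \<mapsto> L x + b\<close>, so their transition Jacobian is locally constant. The second
  derivatives of the transition map, which spoil the tensor law for a general change of coordinates, vanish. Hence the second and third
  partial derivatives of the potential are the components of tensors \<open>g\<close> and \<open>A\<close>, and componentwise
  differentiation is a connection, for which coordinate fields are parallel.

  Mixed partial derivatives commute (\<open>smooth_on_partial_commute\<close>, from an estimate of second
  differences). This gives the symmetry of \<open>g\<close> and \<open>A\<close> when applied to the potential, and the vanishing
  of the curvature when applied to the components of a vector field (\<open>second_directional_commute\<close>).
  The covariant derivative of \<open>g\<close> is \<open>A\<close> (\<open>cov_deriv_g_eq_A\<close>), because the product rule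
  leaves only the derivatives of the components of \<open>g\<close>; so it is symmetric. The Monge-Ampere condition makes the
  determinant of the Hessian nonzero, hence \<open>g\<close> nondegenerate.

  The product \<open>X \<circ> Y\<close> obtained by raising an index of \<open>A\<close> is the only vector with
  \<open>g(X \<circ> Y, Z) = A(X, Y, Z)\<close> for all \<open>Z\<close> (\<open>bil_raised_product\<close> and
  \<open>bil_nondegenerate\<close>). That characterisation does not mention coordinates, so the product of vector fields is
  a vector field, smooth because an inverse matrix is a rational function of the entries (Cramer's rule);
  and the symmetry of \<open>A\<close> turns it into \<open>g(X \<circ> Y, Z) = g(X, Y \<circ> Z)\<close>.

  The domain case is the manifold case for the atlas with the identity as its single chart: the Hessian in
  any other flat chart is \<open>L\<^sup>T H L\<close> with \<open>L\<close> invertible, so smoothness and nondegeneracy of the Hessian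
  need only be known on an atlas (\<open>hessian_manifold_from_atlas\<close>).\<close>


section \<open>Smooth functions\<close>

lemma differentiable_cong_open:
  assumes "open S" "x \<in> S" "\<And>y. y \<in> S \<Longrightarrow> f y = g y" "f differentiable (at x)"
  shows "g differentiable (at x)"
  using assms unfolding differentiable_def
  by (meson has_derivative_transform_within_open)

lemma frechet_derivative_cong_open:
  assumes "open S" "x \<in> S" "\<And>y. y \<in> S \<Longrightarrow> f y = g y"
  shows "frechet_derivative f (at x) = frechet_derivative g (at x)"
proof -
  have "(f has_derivative D) (at x) \<longleftrightarrow> (g has_derivative D) (at x)" for D
    using assms by (metis has_derivative_transform_within_open)
  then show ?thesis by (simp add: frechet_derivative_def)
qed

lemma partial_cong_open:
  assumes "open S" "x \<in> S" "\<And>y. y \<in> S \<Longrightarrow> f y = g y"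
  shows "partial i f x = partial i g x"
  using frechet_derivative_cong_open[OF assms] by (simp add: partial_def)

lemma partial_eqI:
  assumes "(f has_derivative f') (at x)"
  shows "partial i f x = f' (axis i 1)"
  using frechet_derivative_at[OF assms] by (simp add: partial_def)

lemma frechet_derivative_eq_sum_partial:
  fixes f :: "real^'n \<Rightarrow> 'b::real_normed_vector"
  assumes "f differentiable (at x)"
  shows "frechet_derivative f (at x) v = (\<Sum>i\<in>UNIV. v $ i *\<^sub>R partial i f x)"
proof -
  have lin: "linear (frechet_derivative f (at x))"
    using assms by (rule linear_frechet_derivative)
  have "v = (\<Sum>i\<in>UNIV. v $ i *\<^sub>R axis i 1)"
    using basis_expansion[of v] by (simp add: scalar_mult_eq_scaleR)
  then have "frechet_derivative f (at x) v
      = frechet_derivative f (at x) (\<Sum>i\<in>UNIV. v $ i *\<^sub>R axis i 1)" by simp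
  also have "\<dots> = (\<Sum>i\<in>UNIV. v $ i *\<^sub>R partial i f x)"
    by (simp add: linear_sum[OF lin] linear_cmul[OF lin] partial_def)
  finally show ?thesis .
qed

text \<open>Smoothness with a bound on the order: closure properties are proved by induction on the order, since
  the first derivatives of a product or a reciprocal are again built from functions that are smooth to one
  order less.\<close>

definition smooth_upto :: "nat \<Rightarrow> (real^'n) set \<Rightarrow> (real^'n \<Rightarrow> 'b::real_normed_vector) \<Rightarrow> bool" where
  "smooth_upto k S f \<longleftrightarrow>
     (\<forall>ks. length ks \<le> k \<longrightarrow> (\<forall>x\<in>S. foldr partial ks f differentiable (at x)))"

lemma smooth_on_iff_smooth_upto: "smooth_on S f \<longleftrightarrow> (\<forall>k. smooth_upto k S f)"
  by (auto simp: smooth_on_def smooth_upto_def)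

lemma smooth_upto_0: "smooth_upto 0 S f \<longleftrightarrow> (\<forall>x\<in>S. f differentiable (at x))"
  by (simp add: smooth_upto_def)

text \<open>A list of directions is differentiated from its last entry to its first, so the recursion
  splits off the last entry: that derivative is the first one to be taken.\<close>

lemma smooth_upto_Suc:
  "smooth_upto (Suc k) S f \<longleftrightarrow>
     (\<forall>x\<in>S. f differentiable (at x)) \<and> (\<forall>i. smooth_upto k S (partial i f))"
proof
  assume L: "smooth_upto (Suc k) S f"
  have "foldr partial ks (partial i f) differentiable (at x)"
    if "length ks \<le> k" "x \<in> S" for ks i x
    using L that unfolding smooth_upto_def by (auto dest: spec[of _ "ks @ [i]"])
  with L show "(\<forall>x\<in>S. f differentiable (at x)) \<and> (\<forall>i. smooth_upto k S (partial i f))"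
    unfolding smooth_upto_def by (auto dest: spec[of _ "[]"])
next
  assume R: "(\<forall>x\<in>S. f differentiable (at x)) \<and> (\<forall>i. smooth_upto k S (partial i f))"
  show "smooth_upto (Suc k) S f"
    unfolding smooth_upto_def
  proof (intro allI impI ballI)
    fix ks :: "'a list" and x assume "length ks \<le> Suc k" "x \<in> S"
    then show "foldr partial ks f differentiable at x"
      using R by (cases ks rule: rev_cases) (auto simp: smooth_upto_def)
  qed
qed

lemma smooth_upto_le: "smooth_upto k S f \<Longrightarrow> l \<le> k \<Longrightarrow> smooth_upto l S f"
  by (auto simp: smooth_upto_def)

lemma smooth_upto_differentiable:
  "smooth_upto k S f \<Longrightarrow> x \<in> S \<Longrightarrow> f differentiable (at x)"
  using smooth_upto_le[of k S f 0] by (simp add: smooth_upto_0)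

lemma smooth_on_differentiable: "smooth_on S f \<Longrightarrow> x \<in> S \<Longrightarrow> f differentiable (at x)"
  by (meson smooth_on_iff_smooth_upto smooth_upto_differentiable)

lemma smooth_on_partial: "smooth_on S f \<Longrightarrow> smooth_on S (partial i f)"
  by (meson smooth_on_iff_smooth_upto smooth_upto_Suc)

lemma smooth_on_subset: "smooth_on S f \<Longrightarrow> T \<subseteq> S \<Longrightarrow> smooth_on T f"
  by (auto simp: smooth_on_def)

text \<open>Smoothness on a set is a condition at each of its points.\<close>

lemma smooth_on_local:
  "(\<And>x. x \<in> S \<Longrightarrow> \<exists>T. x \<in> T \<and> smooth_on T f) \<Longrightarrow> smooth_on S f"
  unfolding smooth_on_def by blast

lemma smooth_upto_cong:
  assumes "open S" "\<And>x. x \<in> S \<Longrightarrow> f x = g x" "smooth_upto k S f"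
  shows "smooth_upto k S g"
  using assms(2,3)
proof (induction k arbitrary: f g)
  case 0
  then show ?case using differentiable_cong_open[OF assms(1), of _ f g] by (simp add: smooth_upto_0)
next
  case (Suc k)
  have "smooth_upto k S (partial i g)" for i
    by (rule Suc.IH[of "partial i f"])
      (use Suc.prems partial_cong_open[OF assms(1), of _ f g] in \<open>auto simp: smooth_upto_Suc\<close>)
  then show ?case
    using Suc.prems differentiable_cong_open[OF assms(1), of _ f g] by (simp add: smooth_upto_Suc)
qed

lemma smooth_on_cong:
  assumes "open S" "\<And>x. x \<in> S \<Longrightarrow> f x = g x" "smooth_on S f"
  shows "smooth_on S g"
  using smooth_upto_cong[OF assms(1,2)] assms(3) by (auto simp: smooth_on_iff_smooth_upto)

lemma smooth_upto_SucI:
  assumes "open S"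
    and "\<And>x. x \<in> S \<Longrightarrow> (f has_derivative f' x) (at x)"
    and "\<And>i. smooth_upto k S (\<lambda>x. f' x (axis i 1))"
  shows "smooth_upto (Suc k) S f"
  unfolding smooth_upto_Suc
proof (intro conjI ballI allI)
  fix x assume "x \<in> S" then show "f differentiable at x" using assms(2) by (auto simp: differentiable_def)
next
  fix i show "smooth_upto k S (partial i f)"
    by (rule smooth_upto_cong[OF assms(1) _ assms(3)[of i]]) (use partial_eqI assms(2) in metis)
qed

lemma smooth_upto_has_derivative:
  "smooth_upto k S f \<Longrightarrow> x \<in> S \<Longrightarrow> (f has_derivative frechet_derivative f (at x)) (at x)"
  using smooth_upto_differentiable frechet_derivative_works by blast

lemma smooth_upto_const: "open S \<Longrightarrow> smooth_upto k S (\<lambda>x. c)"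
proof (induction k arbitrary: c)
  case (Suc k)
  then show ?case by (intro smooth_upto_SucI[where f' = "\<lambda>x h. 0"]) (auto intro!: derivative_eq_intros)
qed (simp add: smooth_upto_0)

lemma smooth_upto_linear:
  assumes "bounded_linear h" "open S"
  shows "smooth_upto k S f \<Longrightarrow> smooth_upto k S (\<lambda>x. h (f x))"
proof (induction k arbitrary: f)
  case 0
  then show ?case
    using bounded_linear.has_derivative[OF assms(1)]
    unfolding smooth_upto_0 differentiable_def by blast
next
  case (Suc k)
  show ?case
  proof (rule smooth_upto_SucI[OF assms(2)])
    show "((\<lambda>x. h (f x)) has_derivative (\<lambda>v. h (frechet_derivative f (at x) v))) (at x)" if "x \<in> S" for x
      using bounded_linear.has_derivative[OF assms(1) smooth_upto_has_derivative[OF Suc.prems that]] .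
    show "smooth_upto k S (\<lambda>x. h (frechet_derivative f (at x) (axis i 1)))" for i
      using Suc.IH[of "partial i f"] Suc.prems by (simp add: smooth_upto_Suc partial_def[abs_def])
  qed
qed

lemma smooth_upto_add:
  assumes "open S"
  shows "smooth_upto k S f \<Longrightarrow> smooth_upto k S g \<Longrightarrow> smooth_upto k S (\<lambda>x. f x + g x)"
proof (induction k arbitrary: f g)
  case 0
  then show ?case by (auto simp: smooth_upto_0)
next
  case (Suc k)
  show ?case
  proof (rule smooth_upto_SucI[OF assms])
    show "((\<lambda>x. f x + g x) has_derivative
        (\<lambda>v. frechet_derivative f (at x) v + frechet_derivative g (at x) v)) (at x)" if "x \<in> S" for x
      using Suc.prems that by (intro has_derivative_add smooth_upto_has_derivative)
    show "smooth_upto k S (\<lambda>x. frechet_derivative f (at x) (axis i 1) + frechet_derivative g (at x) (axis i 1))" for i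
      using Suc.IH[of "partial i f" "partial i g"] Suc.prems by (simp add: smooth_upto_Suc partial_def[abs_def])
  qed
qed

lemma smooth_upto_bilinear:
  assumes "bounded_bilinear h" "open S"
  shows "smooth_upto k S f \<Longrightarrow> smooth_upto k S g \<Longrightarrow> smooth_upto k S (\<lambda>x. h (f x) (g x))"
proof (induction k arbitrary: f g)
  case 0
  then show ?case
    using bounded_bilinear.FDERIV[OF assms(1)] unfolding smooth_upto_0 differentiable_def by blast
next
  case (Suc k)
  have fg: "smooth_upto k S f" "smooth_upto k S g"
    using Suc.prems by (auto intro: smooth_upto_le)
  show ?case
  proof (rule smooth_upto_SucI[OF assms(2)])
    show "((\<lambda>x. h (f x) (g x)) has_derivative
        (\<lambda>v. h (f x) (frechet_derivative g (at x) v) + h (frechet_derivative f (at x) v) (g x))) (at x)"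
      if "x \<in> S" for x
      using Suc.prems that
      by (intro bounded_bilinear.FDERIV[OF assms(1)] smooth_upto_has_derivative)
    show "smooth_upto k S (\<lambda>x. h (f x) (frechet_derivative g (at x) (axis i 1))
        + h (frechet_derivative f (at x) (axis i 1)) (g x))" for i
      using Suc.IH[of f "partial i g"] Suc.IH[of "partial i f" g] Suc.prems fg
      by (intro smooth_upto_add[OF assms(2)]) (simp_all add: smooth_upto_Suc partial_def[abs_def])
  qed
qed

text \<open>The derivative of the reciprocal is \<open>- (1/f) f' (1/f)\<close>, which again contains the reciprocal only;
  the induction hypothesis covers it with one order less.\<close>

lemma smooth_upto_inverse:
  fixes f :: "real^'n \<Rightarrow> real"
  assumes "open S" "\<And>x. x \<in> S \<Longrightarrow> f x \<noteq> 0"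
  shows "smooth_upto k S f \<Longrightarrow> smooth_upto k S (\<lambda>x. inverse (f x))"
proof (induction k)
  case 0
  then show ?case using assms(2) by (auto simp: smooth_upto_0)
next
  case (Suc k)
  have inv: "smooth_upto k S (\<lambda>x. inverse (f x))"
    using Suc.IH smooth_upto_le[OF Suc.prems] by simp
  show ?case
  proof (rule smooth_upto_SucI[OF assms(1)])
    show "((\<lambda>x. inverse (f x)) has_derivative
        (\<lambda>v. - (inverse (f x) * frechet_derivative f (at x) v * inverse (f x)))) (at x)"
      if "x \<in> S" for x
      using Suc.prems that assms(2)
      by (intro Deriv.has_derivative_inverse smooth_upto_has_derivative) auto
    show "smooth_upto k S (\<lambda>x. - (inverse (f x) * frechet_derivative f (at x) (axis i 1) * inverse (f x)))" for i
    proof -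
      have "smooth_upto k S (\<lambda>x. inverse (f x) * partial i f x * inverse (f x))"
        using Suc.prems by (intro smooth_upto_bilinear[OF bounded_bilinear_mult] assms(1) inv)
          (simp add: smooth_upto_Suc)
      from smooth_upto_linear[OF bounded_linear_minus[OF bounded_linear_ident] assms(1) this]
      show ?thesis by (simp add: partial_def)
    qed
  qed
qed

lemma smooth_on_linear:
  "bounded_linear h \<Longrightarrow> open S \<Longrightarrow> smooth_on S f \<Longrightarrow> smooth_on S (\<lambda>x. h (f x))"
  by (simp add: smooth_on_iff_smooth_upto smooth_upto_linear[of h S _ f])

lemma smooth_on_const: "open S \<Longrightarrow> smooth_on S (\<lambda>x. c)"
  by (simp add: smooth_on_iff_smooth_upto smooth_upto_const)

lemma smooth_on_add:
  "open S \<Longrightarrow> smooth_on S f \<Longrightarrow> smooth_on S g \<Longrightarrow> smooth_on S (\<lambda>x. f x + g x)"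
  by (simp add: smooth_on_iff_smooth_upto smooth_upto_add)

lemma smooth_on_scaleR:
  "open S \<Longrightarrow> smooth_on S f \<Longrightarrow> smooth_on S g \<Longrightarrow> smooth_on S (\<lambda>x. f x *\<^sub>R g x)"
  by (simp add: smooth_on_iff_smooth_upto smooth_upto_bilinear[OF bounded_bilinear_scaleR])

lemma smooth_on_mult:
  fixes f g :: "real^'n \<Rightarrow> real"
  shows "open S \<Longrightarrow> smooth_on S f \<Longrightarrow> smooth_on S g \<Longrightarrow> smooth_on S (\<lambda>x. f x * g x)"
  by (simp add: smooth_on_iff_smooth_upto smooth_upto_bilinear[OF bounded_bilinear_mult])

lemma smooth_on_inverse:
  fixes f :: "real^'n \<Rightarrow> real"
  shows "open S \<Longrightarrow> (\<And>x. x \<in> S \<Longrightarrow> f x \<noteq> 0) \<Longrightarrow> smooth_on S f \<Longrightarrow> smooth_on S (\<lambda>x. inverse (f x))"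
  by (simp add: smooth_on_iff_smooth_upto smooth_upto_inverse)

lemma smooth_on_sum:
  "open S \<Longrightarrow> (\<And>i. i \<in> I \<Longrightarrow> smooth_on S (f i)) \<Longrightarrow> smooth_on S (\<lambda>x. \<Sum>i\<in>I. f i x)"
  by (induction I rule: infinite_finite_induct) (auto simp: smooth_on_const smooth_on_add)

lemma smooth_on_prod:
  fixes f :: "'i \<Rightarrow> real^'n \<Rightarrow> real"
  shows "open S \<Longrightarrow> (\<And>i. i \<in> I \<Longrightarrow> smooth_on S (f i)) \<Longrightarrow> smooth_on S (\<lambda>x. \<Prod>i\<in>I. f i x)"
  by (induction I rule: infinite_finite_induct) (auto simp: smooth_on_const smooth_on_mult)

lemma smooth_on_vec_nth:
  "open S \<Longrightarrow> smooth_on S f \<Longrightarrow> smooth_on S (\<lambda>x. f x $ i)"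
  by (rule smooth_on_linear[OF bounded_linear_vec_nth])

lemma bounded_linear_axis: "bounded_linear (axis i :: 'b::real_normed_vector \<Rightarrow> 'b^'k)"
proof (rule bounded_linear_intro[where K = 1])
  fix x y :: 'b and r :: real
  show "axis i (x + y) = (axis i x + axis i y :: 'b^'k)" by (simp add: vec_eq_iff axis_def)
  show "axis i (r *\<^sub>R x) = (r *\<^sub>R axis i x :: 'b^'k)" by (simp add: vec_eq_iff axis_def)
  have "norm (axis i x :: 'b^'k) \<le> (\<Sum>j\<in>UNIV. norm (axis i x $ j))"
    by (simp add: norm_vec_def L2_set_le_sum)
  also have "\<dots> = norm x" by (simp add: axis_def if_distrib[of norm] cong: if_cong)
  finally show "norm (axis i x :: 'b^'k) \<le> norm x * 1" by simp
qed

lemma smooth_on_vec_lambda: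
  fixes f :: "'k::finite \<Rightarrow> real^'n \<Rightarrow> 'b::real_normed_vector"
  assumes "open S" "\<And>i. smooth_on S (f i)"
  shows "smooth_on S (\<lambda>x. \<chi> i. f i x)"
proof -
  have "(\<lambda>x. \<chi> i. f i x) = (\<lambda>x. \<Sum>i\<in>UNIV. axis i (f i x))"
    by (auto simp: vec_eq_iff axis_def fun_eq_iff)
  then show ?thesis
    using assms by (auto intro!: smooth_on_sum smooth_on_linear[OF bounded_linear_axis])
qed

lemma smooth_on_det:
  fixes G :: "real^'n \<Rightarrow> real^'k^'k"
  assumes "open S" "\<And>i j. smooth_on S (\<lambda>x. G x $ i $ j)"
  shows "smooth_on S (\<lambda>x. det (G x))"
  unfolding det_def using assms
  by (intro smooth_on_sum smooth_on_mult smooth_on_const smooth_on_prod)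

lemma matrix_inv_cancel:
  fixes A :: "real^'k^'k"
  assumes "det A \<noteq> 0"
  shows "A ** matrix_inv A = mat 1" "matrix_inv A ** A = mat 1"
  using someI_ex[OF assms[folded invertible_det_nz, unfolded invertible_def]]
  by (simp_all add: matrix_inv_def)

text \<open>Column \<open>j\<close> of the inverse solves a linear system, so Cramer's rule expresses its entries by determinants,
  that is, by sums and products of entries of the matrix and one reciprocal.\<close>

lemma smooth_on_matrix_inv:
  fixes G :: "real^'n \<Rightarrow> real^'k^'k"
  assumes S: "open S" and G: "smooth_on S G" and nz: "\<And>x. x \<in> S \<Longrightarrow> det (G x) \<noteq> 0"
  shows "smooth_on S (\<lambda>x. matrix_inv (G x) $ i $ j)"
proof -
  let ?C = "\<lambda>x. \<chi> a b. if b = i then axis j 1 $ a else G x $ a $ b"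
  have Gij: "smooth_on S (\<lambda>x. G x $ a $ b)" for a b
    by (intro smooth_on_vec_nth S G)
  have "smooth_on S (\<lambda>x. ?C x $ a $ b)" for a b
    using smooth_on_const[OF S] Gij by (cases "b = i") simp_all
  then have sm: "smooth_on S (\<lambda>x. det (?C x) * inverse (det (G x)))"
    by (intro smooth_on_mult smooth_on_inverse smooth_on_det S nz Gij)
  have eq: "det (?C x) * inverse (det (G x)) = matrix_inv (G x) $ i $ j" if "x \<in> S" for x
  proof -
    have "G x *v (matrix_inv (G x) *v axis j 1) = axis j 1"
      using nz[OF that]
      by (simp add: matrix_vector_mul_assoc matrix_inv_cancel)
    from iffD1[OF cramer[OF nz[OF that]] this]
    have "(matrix_inv (G x) *v axis j 1) $ i = det (?C x) / det (G x)" by simp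
    moreover have "(matrix_inv (G x) *v axis j 1) $ i = matrix_inv (G x) $ i $ j"
      by (simp add: matrix_vector_mult_basis column_def)
    ultimately show ?thesis by (simp add: divide_inverse)
  qed
  show ?thesis by (rule smooth_on_cong[OF S eq sm])
qed

lemma has_derivative_affine: "((\<lambda>x::real^'n. L *v x + b) has_derivative (\<lambda>v. L *v v)) (at x)"
  by (auto intro!: derivative_eq_intros bounded_linear.has_derivative[OF matrix_vector_mul_bounded_linear])

lemma has_derivative_compose_affine:
  fixes L :: "real^'n^'m"
  assumes "open S" "x \<in> S" "\<And>y. y \<in> S \<Longrightarrow> f y = g (L *v y + b)" "g differentiable (at (L *v x + b))"
  shows "(f has_derivative (\<lambda>v. frechet_derivative g (at (L *v x + b)) (L *v v))) (at x)"
proof -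
  have "((\<lambda>y. g (L *v y + b)) has_derivative (\<lambda>v. frechet_derivative g (at (L *v x + b)) (L *v v))) (at x)"
    using diff_chain_at[OF has_derivative_affine, of g _ L x b] assms(4)
    by (simp add: frechet_derivative_works o_def)
  then show ?thesis
    by (rule has_derivative_transform_within_open) (use assms(1-3) in auto)
qed

lemma partial_affine:
  fixes L :: "real^'n^'m"
  assumes "open S" "x \<in> S" "\<And>y. y \<in> S \<Longrightarrow> f y = g (L *v y + b)" "g differentiable (at (L *v x + b))"
  shows "partial i f x = (\<Sum>j\<in>UNIV. L $ j $ i *\<^sub>R partial j g (L *v x + b))"
  using partial_eqI[OF has_derivative_compose_affine[OF assms], of i]
  by (simp add: frechet_derivative_eq_sum_partial[OF assms(4)] matrix_vector_mult_basis column_def)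

lemma smooth_upto_affine:
  fixes L :: "real^'n^'m"
  assumes "open S"
  shows "smooth_upto k T g \<Longrightarrow> (\<And>y. y \<in> S \<Longrightarrow> L *v y + b \<in> T) \<Longrightarrow> smooth_upto k S (\<lambda>y. g (L *v y + b))"
proof (induction k arbitrary: g)
  case 0
  then show ?case
    using has_derivative_compose_affine[OF assms, of _ "\<lambda>y. g (L *v y + b)" g L b]
    by (auto simp: smooth_upto_0 differentiable_def)
next
  case (Suc k)
  have d: "g differentiable at (L *v x + b)" if "x \<in> S" for x
    using Suc.prems that by (auto simp: smooth_upto_Suc)
  have *: "smooth_upto k S (\<lambda>x. \<Sum>j\<in>I. L $ j $ i *\<^sub>R partial j g (L *v x + b))" for I and i
    using Suc.IH[of "partial _ g"] Suc.prems
    by (induction I rule: infinite_finite_induct)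
      (auto simp: smooth_upto_Suc assms intro!: smooth_upto_const smooth_upto_add
        smooth_upto_linear[OF bounded_linear_scaleR_right])
  show ?case
    by (rule smooth_upto_SucI[OF assms has_derivative_compose_affine[OF assms]])
      (use d in \<open>auto intro!: smooth_upto_cong[OF assms _ *]
        simp: frechet_derivative_eq_sum_partial matrix_vector_mult_basis column_def\<close>)
qed

lemma smooth_on_affine:
  fixes L :: "real^'n^'m"
  assumes "open S" "\<And>y. y \<in> S \<Longrightarrow> L *v y + b \<in> T" "smooth_on T g"
    "\<And>y. y \<in> S \<Longrightarrow> f y = g (L *v y + b)"
  shows "smooth_on S f"
  by (rule smooth_on_cong[OF assms(1), of "\<lambda>y. g (L *v y + b)"])
    (use assms smooth_upto_affine[OF assms(1), of _ T g L b] in \<open>auto simp: smooth_on_iff_smooth_upto\<close>)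

section \<open>Mixed partial derivatives commute\<close>

text \<open>By the mean value theorem the second difference is \<open>t\<close> times the increment of \<open>partial i f\<close> between
  two points at distance \<open>t\<close> in direction \<open>j\<close>; both lie within distance \<open>2 t\<close> of \<open>x\<close>, so the
  linear approximation of \<open>partial i f\<close> at \<open>x\<close> evaluates that increment up to \<open>e t\<close>.\<close>

lemma second_difference_estimate:
  fixes f :: "real^'n \<Rightarrow> real"
  assumes S: "open S" "x \<in> S" and f: "\<And>y. y \<in> S \<Longrightarrow> f differentiable (at y)"
    and fi: "partial i f differentiable (at x)" and e: "e > 0"
  shows "\<exists>d>0. \<forall>t. 0 < t \<and> t < d \<longrightarrow>
    \<bar>f (x + t *\<^sub>R axis i 1 + t *\<^sub>R axis j 1) - f (x + t *\<^sub>R axis i 1) - f (x + t *\<^sub>R axis j 1) + f x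
       - t\<^sup>2 * partial j (partial i f) x\<bar> \<le> e * t\<^sup>2"
proof -
  define ei ej :: "real^'n" where "ei = axis i 1" and "ej = axis j 1"
  have nrm: "norm ei = 1" "norm ej = 1" by (simp_all add: ei_def ej_def)
  define D where "D = frechet_derivative (partial i f) (at x)"
  have D: "(partial i f has_derivative D) (at x)" using fi frechet_derivative_works D_def by blast
  then have lin: "linear D" by (rule has_derivative_linear)
  have Dj: "D ej = partial j (partial i f) x" by (simp add: D_def ej_def partial_def)
  obtain r where r: "r > 0" "ball x r \<subseteq> S" using S open_contains_ball by blast
  \<comment> \<open>A third of \<open>e\<close>: the two points are at distance at most \<open>2 t\<close> and \<open>t\<close> from \<open>x\<close>, and the errors add up.\<close>
  obtain d where d: "d > 0" and
    dd: "\<And>y. norm (y - x) < d \<Longrightarrow> \<bar>partial i f y - partial i f x - D (y - x)\<bar> \<le> e / 3 * norm (y - x)"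
    using D e unfolding has_derivative_at_alt real_norm_def by (meson divide_pos_pos zero_less_numeral)
  show ?thesis
    unfolding ei_def[symmetric] ej_def[symmetric]
  proof (intro exI[of _ "min r d / 2"] conjI allI impI)
    show "0 < min r d / 2" using r d by simp
    fix t assume t: "0 < t \<and> t < min r d / 2"
    have near: "norm (s *\<^sub>R ei + u *\<^sub>R ej) \<le> s + u" if "0 \<le> s" "0 \<le> u" for s u
      using norm_triangle_ineq[of "s *\<^sub>R ei" "u *\<^sub>R ej"] that nrm by simp
    have inS: "x + s *\<^sub>R ei + u *\<^sub>R ej \<in> S" if "0 \<le> s" "0 \<le> u" "s \<le> t" "u \<le> t" for s u
    proof -
      have "norm (s *\<^sub>R ei + u *\<^sub>R ej) < r" using near[of s u] that t by auto
      then have "x + (s *\<^sub>R ei + u *\<^sub>R ej) \<in> ball x r"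
        by (metis add_diff_cancel_left' dist_norm mem_ball norm_minus_commute)
      then show ?thesis using r(2) by (auto simp: add.assoc)
    qed
    have der: "((\<lambda>s. f (x + s *\<^sub>R ei + u *\<^sub>R ej)) has_real_derivative
        partial i f (x + s *\<^sub>R ei + u *\<^sub>R ej)) (at s)"
      if "0 \<le> s" "0 \<le> u" "s \<le> t" "u \<le> t" for s u
    proof -
      let ?y = "x + s *\<^sub>R ei + u *\<^sub>R ej"
      have F: "(f has_derivative frechet_derivative f (at ?y)) (at ?y)"
        using f[OF inS[OF that]] frechet_derivative_works by blast
      have G: "((\<lambda>s. x + s *\<^sub>R ei + u *\<^sub>R ej) has_derivative (\<lambda>h. h *\<^sub>R ei)) (at s)"
        by (auto intro!: derivative_eq_intros)
      have "((\<lambda>s. f (x + s *\<^sub>R ei + u *\<^sub>R ej)) has_derivative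
          (\<lambda>h. frechet_derivative f (at ?y) (h *\<^sub>R ei))) (at s)"
        using diff_chain_at[OF G F] by (simp add: o_def)
      moreover have "frechet_derivative f (at ?y) (h *\<^sub>R ei) = partial i f ?y * h" for h
        using linear_cmul[OF has_derivative_linear[OF F]] by (simp add: partial_def ei_def)
      ultimately show ?thesis by (simp add: has_field_derivative_def)
    qed
    \<comment> \<open>The summand with factor \<open>0\<close> gives both terms the shape required by \<open>der\<close>.\<close>
    define \<phi> where "\<phi> s = f (x + s *\<^sub>R ei + t *\<^sub>R ej) - f (x + s *\<^sub>R ei + 0 *\<^sub>R ej)" for s
    have "(\<phi> has_real_derivative
        partial i f (x + s *\<^sub>R ei + t *\<^sub>R ej) - partial i f (x + s *\<^sub>R ei + 0 *\<^sub>R ej)) (at s)"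
      if "0 \<le> s" "s \<le> t" for s
      unfolding \<phi>_def using that t by (intro DERIV_diff der) auto
    then obtain s where s: "0 < s" "s < t" and
      mvt: "\<phi> t - \<phi> 0 = (t - 0) * (partial i f (x + s *\<^sub>R ei + t *\<^sub>R ej) - partial i f (x + s *\<^sub>R ei + 0 *\<^sub>R ej))"
      using MVT2[of 0 t \<phi> "\<lambda>s. partial i f (x + s *\<^sub>R ei + t *\<^sub>R ej) - partial i f (x + s *\<^sub>R ei + 0 *\<^sub>R ej)"] t
      by blast
    let ?a = "partial i f (x + s *\<^sub>R ei + t *\<^sub>R ej)" and ?b = "partial i f (x + s *\<^sub>R ei)"
    have a: "\<bar>?a - partial i f x - D (s *\<^sub>R ei + t *\<^sub>R ej)\<bar> \<le> e / 3 * (2 * t)"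
    proof -
      have n: "norm (s *\<^sub>R ei + t *\<^sub>R ej) \<le> 2 * t" using near[of s t] s by simp
      then have "\<bar>?a - partial i f x - D (s *\<^sub>R ei + t *\<^sub>R ej)\<bar> \<le> e / 3 * norm (s *\<^sub>R ei + t *\<^sub>R ej)"
        using dd[of "x + s *\<^sub>R ei + t *\<^sub>R ej"] t by (simp add: add.assoc)
      also have "\<dots> \<le> e / 3 * (2 * t)" using n e by (intro mult_left_mono) auto
      finally show ?thesis .
    qed
    have b: "\<bar>?b - partial i f x - D (s *\<^sub>R ei)\<bar> \<le> e / 3 * t"
    proof -
      have n: "norm (s *\<^sub>R ei) \<le> t" using s nrm by simp
      then have "\<bar>?b - partial i f x - D (s *\<^sub>R ei)\<bar> \<le> e / 3 * norm (s *\<^sub>R ei)"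
        using dd[of "x + s *\<^sub>R ei"] t by simp
      also have "\<dots> \<le> e / 3 * t" using n e by (intro mult_left_mono) auto
      finally show ?thesis .
    qed
    have "D (s *\<^sub>R ei + t *\<^sub>R ej) = D (s *\<^sub>R ei) + t * partial j (partial i f) x"
      using linear_add[OF lin] linear_cmul[OF lin] Dj by simp
    moreover have "\<bar>u - v - (q - p)\<bar> \<le> h + k" if "\<bar>u - w - q\<bar> \<le> h" "\<bar>v - w - p\<bar> \<le> k"
      for u v w p q h k :: real
      using that by linarith
    from this[OF a b] have "\<bar>?a - ?b - (D (s *\<^sub>R ei + t *\<^sub>R ej) - D (s *\<^sub>R ei))\<bar> \<le> e * t" by simp
    ultimately have "\<bar>?a - ?b - t * partial j (partial i f) x\<bar> \<le> e * t" by simp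
    then have "t * \<bar>?a - ?b - t * partial j (partial i f) x\<bar> \<le> t * (e * t)"
      using t by (intro mult_left_mono) auto
    then have "\<bar>t * (?a - ?b - t * partial j (partial i f) x)\<bar> \<le> t * (e * t)"
      using t by (simp add: abs_mult)
    moreover have "f (x + t *\<^sub>R ei + t *\<^sub>R ej) - f (x + t *\<^sub>R ei) - f (x + t *\<^sub>R ej) + f x
        = t * (?a - ?b)"
      using mvt by (simp add: \<phi>_def)
    ultimately show "\<bar>f (x + t *\<^sub>R ei + t *\<^sub>R ej) - f (x + t *\<^sub>R ei) - f (x + t *\<^sub>R ej) + f x
       - t\<^sup>2 * partial j (partial i f) x\<bar> \<le> e * t\<^sup>2"
      by (simp add: power2_eq_square algebra_simps)
  qed
qed

text \<open>The second difference is symmetric in \<open>i\<close> and \<open>j\<close>, so both mixed derivatives are its limit after division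
  by \<open>t\<^sup>2\<close>.\<close>

lemma partial_commute_real:
  fixes f :: "real^'n \<Rightarrow> real"
  assumes S: "open S" "x \<in> S" and f: "\<And>y. y \<in> S \<Longrightarrow> f differentiable (at y)"
    and fi: "\<And>i. partial i f differentiable (at x)"
  shows "partial i (partial j f) x = partial j (partial i f) x"
proof -
  have le: "\<bar>partial i (partial j f) x - partial j (partial i f) x\<bar> \<le> e" if e: "e > 0" for e
  proof -
    have e2: "e / 2 > 0" using e by simp
    let ?\<Delta> = "\<lambda>t. f (x + t *\<^sub>R axis i 1 + t *\<^sub>R axis j 1) - f (x + t *\<^sub>R axis i 1) - f (x + t *\<^sub>R axis j 1) + f x"
    obtain d1 where d1: "d1 > 0 \<and> (\<forall>t. 0 < t \<and> t < d1 \<longrightarrow>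
        \<bar>?\<Delta> t - t\<^sup>2 * partial j (partial i f) x\<bar> \<le> e / 2 * t\<^sup>2)"
      using second_difference_estimate[OF S f fi[of i] e2, of j] by (rule exE)
    obtain d2 where d2: "d2 > 0 \<and> (\<forall>t. 0 < t \<and> t < d2 \<longrightarrow>
        \<bar>f (x + t *\<^sub>R axis j 1 + t *\<^sub>R axis i 1) - f (x + t *\<^sub>R axis j 1) - f (x + t *\<^sub>R axis i 1) + f x
           - t\<^sup>2 * partial i (partial j f) x\<bar> \<le> e / 2 * t\<^sup>2)"
      using second_difference_estimate[OF S f fi[of j] e2, of i] by (rule exE)
    define t where "t = min d1 d2 / 2"
    have t: "0 < t" "t < d1" "t < d2" using d1 d2 by (auto simp: t_def)
    have eq: "?\<Delta> t = f (x + t *\<^sub>R axis j 1 + t *\<^sub>R axis i 1) - f (x + t *\<^sub>R axis j 1) - f (x + t *\<^sub>R axis i 1) + f x"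
      by (simp add: algebra_simps)
    have "\<bar>?\<Delta> t - t\<^sup>2 * partial i (partial j f) x\<bar> \<le> e / 2 * t\<^sup>2"
      unfolding eq using d2 t by blast
    moreover have "\<bar>v - u\<bar> \<le> 2 * h" if "\<bar>w - u\<bar> \<le> h" "\<bar>w - v\<bar> \<le> h" for u v w h :: real
      using that by linarith
    ultimately have "\<bar>t\<^sup>2 * partial i (partial j f) x - t\<^sup>2 * partial j (partial i f) x\<bar> \<le> 2 * (e / 2 * t\<^sup>2)"
      using d1 t by blast
    also have "\<bar>t\<^sup>2 * partial i (partial j f) x - t\<^sup>2 * partial j (partial i f) x\<bar>
        = t\<^sup>2 * \<bar>partial i (partial j f) x - partial j (partial i f) x\<bar>"
      by (metis abs_mult abs_power2 right_diff_distrib)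
    finally have "t\<^sup>2 * \<bar>partial i (partial j f) x - partial j (partial i f) x\<bar> \<le> t\<^sup>2 * e"
      by (simp add: mult.commute)
    then show ?thesis using t(1) by simp
  qed
  have "\<bar>partial i (partial j f) x - partial j (partial i f) x\<bar> \<le> 0"
    by (rule field_le_epsilon) (simp add: le)
  then show ?thesis by simp
qed

lemma partial_vec_nth:
  assumes "f differentiable (at x)"
  shows "partial i (\<lambda>x. f x $ k) x = partial i f x $ k"
proof -
  have "((\<lambda>x. f x $ k) has_derivative (\<lambda>v. frechet_derivative f (at x) v $ k)) (at x)"
    using assms bounded_linear.has_derivative[OF bounded_linear_vec_nth] frechet_derivative_works by blast
  from partial_eqI[OF this, of i] show ?thesis by (simp add: partial_def)
qed

lemma smooth_on_partial_commute_real: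
  fixes f :: "real^'n \<Rightarrow> real"
  assumes "open S" "smooth_on S f" "x \<in> S"
  shows "partial i (partial j f) x = partial j (partial i f) x"
  by (rule partial_commute_real[OF assms(1,3)])
    (use assms in \<open>auto intro: smooth_on_differentiable smooth_on_partial\<close>)

lemma smooth_on_partial_commute:
  fixes f :: "real^'n \<Rightarrow> real^'k"
  assumes S: "open S" and f: "smooth_on S f" and x: "x \<in> S"
  shows "partial i (partial j f) x = partial j (partial i f) x"
proof -
  have nth: "partial a (partial b f) x $ k = partial a (partial b (\<lambda>x. f x $ k)) x" for a b k
  proof -
    have "partial a (partial b f) x $ k = partial a (\<lambda>x. partial b f x $ k) x"
      by (rule partial_vec_nth[OF smooth_on_differentiable[OF smooth_on_partial[OF f] x], symmetric])
    also have "\<dots> = partial a (partial b (\<lambda>x. f x $ k)) x"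
      by (rule partial_cong_open[OF S x]) (rule partial_vec_nth[OF smooth_on_differentiable[OF f], symmetric])
    finally show ?thesis .
  qed
  show ?thesis
    unfolding vec_eq_iff nth
    by (intro allI smooth_on_partial_commute_real[OF S smooth_on_vec_nth[OF S f] x])
qed

section \<open>Bilinear and trilinear forms and the product they define\<close>

lemma sum_rotate3:
  "(\<Sum>a\<in>A. \<Sum>b\<in>B. \<Sum>e\<in>E. f a b e) = (\<Sum>e\<in>E. \<Sum>a\<in>A. \<Sum>b\<in>B. f a b e)"
  by (simp only: sum.swap[of _ E B]) (rule sum.swap)

definition bil :: "real^'n^'n \<Rightarrow> real^'n \<Rightarrow> real^'n \<Rightarrow> real" where
  "bil H v w = (\<Sum>i\<in>UNIV. \<Sum>j\<in>UNIV. H $ i $ j * v $ i * w $ j)"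

definition tri :: "real^'n^'n^'n \<Rightarrow> real^'n \<Rightarrow> real^'n \<Rightarrow> real^'n \<Rightarrow> real" where
  "tri A u v w = (\<Sum>i\<in>UNIV. \<Sum>j\<in>UNIV. \<Sum>k\<in>UNIV. A $ i $ j $ k * u $ i * v $ j * w $ k)"

text \<open>The pointwise form of \<open>field_mult\<close>: the trilinear form with its last index raised by the inverse
  matrix.\<close>

definition raised_product :: "real^'n^'n \<Rightarrow> real^'n^'n^'n \<Rightarrow> real^'n \<Rightarrow> real^'n \<Rightarrow> real^'n" where
  "raised_product H A u v = (\<chi> k. \<Sum>a\<in>UNIV. \<Sum>b\<in>UNIV. u $ a * v $ b *
     (\<Sum>e\<in>UNIV. A $ a $ b $ e * matrix_inv H $ e $ k))"

lemma bil_inner: "bil H v w = v \<bullet> (H *v w)"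
  by (simp add: bil_def inner_vec_def matrix_vector_mult_def sum_distrib_left mult_ac)

lemma bil_sym: "(\<And>i j. H $ i $ j = H $ j $ i) \<Longrightarrow> bil H v w = bil H w v"
  unfolding bil_def by (subst sum.swap) (simp add: mult_ac)

text \<open>The map \<open>z \<mapsto> H z\<close> is onto, so the form can be tested against a \<open>z\<close> with \<open>H z = v - w\<close>.\<close>

lemma bil_nondegenerate:
  assumes "det H \<noteq> 0" and eq: "\<And>z. bil H v z = bil H w z"
  shows "v = w"
proof -
  let ?z = "matrix_inv H *v (v - w)"
  have "H *v ?z = v - w" using assms(1) by (simp add: matrix_vector_mul_assoc matrix_inv_cancel)
  then have "v \<bullet> (v - w) = w \<bullet> (v - w)" using eq[of ?z] by (simp add: bil_inner)
  then have "(v - w) \<bullet> (v - w) = 0" by (simp add: inner_diff_left)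
  then show ?thesis by simp
qed

lemma congruence_nth:
  fixes J :: "real^'n^'m"
  shows "(transpose J ** H ** J) $ a $ b = (\<Sum>i\<in>UNIV. \<Sum>j\<in>UNIV. J $ i $ a * J $ j $ b * H $ i $ j)"
  unfolding matrix_matrix_mult_def transpose_def
  by (simp add: sum_distrib_left sum_distrib_right mult_ac)
    (subst sum.swap, simp add: mult_ac)

lemma bil_congruence: "bil (transpose J ** H ** J) v w = bil H (J *v v) (J *v w)"
proof -
  have "bil (transpose J ** H ** J) v w = v \<bullet> (transpose J *v (H *v (J *v w)))"
    by (simp only: bil_inner matrix_vector_mul_assoc matrix_mul_assoc)
  also have "\<dots> = (v v* transpose J) \<bullet> (H *v (J *v w))" by (simp only: dot_lmul_matrix)
  also have "v v* transpose J = J *v v" by (metis transpose_matrix_vector transpose_transpose)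
  finally show ?thesis by (simp add: bil_inner)
qed

lemma bil_pullback:
  assumes "\<And>a b. H' $ a $ b = (\<Sum>i\<in>UNIV. \<Sum>j\<in>UNIV. J $ i $ a * J $ j $ b * H $ i $ j)"
  shows "bil H' v w = bil H (J *v v) (J *v w)"
proof -
  have "H' = transpose J ** H ** J" using assms by (simp add: vec_eq_iff congruence_nth)
  then show ?thesis by (simp add: bil_congruence)
qed

lemma tri_eq_sum_bil: "tri A u v w = (\<Sum>i\<in>UNIV. u $ i * bil (A $ i) v w)"
  by (simp add: tri_def bil_def sum_distrib_left mult_ac)

text \<open>The slices \<open>A' $ a\<close> are combinations of congruent bilinear forms \<open>J\<^sup>T (A $ i) J\<close>, which reduces the claim to
  the bilinear case.\<close>

lemma tri_pullback:
  assumes A': "\<And>a b e. A' $ a $ b $ e = (\<Sum>i\<in>UNIV. \<Sum>j\<in>UNIV. \<Sum>k\<in>UNIV.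
      J $ i $ a * J $ j $ b * J $ k $ e * A $ i $ j $ k)"
  shows "tri A' u v w = tri A (J *v u) (J *v v) (J *v w)"
proof -
  have slice: "bil (A' $ a) v w = (\<Sum>i\<in>UNIV. J $ i $ a * bil (A $ i) (J *v v) (J *v w))" for a
  proof -
    have "bil (A' $ a) v w = (\<Sum>b\<in>UNIV. \<Sum>e\<in>UNIV. \<Sum>i\<in>UNIV.
        J $ i $ a * ((\<Sum>j\<in>UNIV. \<Sum>k\<in>UNIV. J $ j $ b * J $ k $ e * A $ i $ j $ k) * v $ b * w $ e))"
      by (simp add: bil_def A' sum_distrib_left sum_distrib_right mult_ac)
    also have "\<dots> = (\<Sum>i\<in>UNIV. \<Sum>b\<in>UNIV. \<Sum>e\<in>UNIV.
        J $ i $ a * ((\<Sum>j\<in>UNIV. \<Sum>k\<in>UNIV. J $ j $ b * J $ k $ e * A $ i $ j $ k) * v $ b * w $ e))"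
      by (rule sum_rotate3)
    also have "\<dots> = (\<Sum>i\<in>UNIV. J $ i $ a * bil (transpose J ** A $ i ** J) v w)"
      by (simp only: bil_def congruence_nth sum_distrib_left)
    finally show ?thesis by (simp add: bil_congruence)
  qed
  have "tri A' u v w = (\<Sum>a\<in>UNIV. \<Sum>i\<in>UNIV. u $ a * (J $ i $ a * bil (A $ i) (J *v v) (J *v w)))"
    by (simp add: tri_eq_sum_bil slice sum_distrib_left)
  also have "\<dots> = (\<Sum>i\<in>UNIV. \<Sum>a\<in>UNIV. u $ a * (J $ i $ a * bil (A $ i) (J *v v) (J *v w)))"
    by (rule sum.swap)
  also have "\<dots> = tri A (J *v u) (J *v v) (J *v w)"
    by (simp add: tri_eq_sum_bil matrix_vector_mult_def sum_distrib_right mult_ac)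
  finally show ?thesis .
qed

lemma tri_sym12: "(\<And>i j k. A $ i $ j $ k = A $ j $ i $ k) \<Longrightarrow> tri A u v w = tri A v u w"
  unfolding tri_def by (subst sum.swap) (simp add: mult_ac)

lemma tri_sym23: "(\<And>i j k. A $ i $ j $ k = A $ i $ k $ j) \<Longrightarrow> tri A u v w = tri A u w v"
  unfolding tri_eq_sum_bil by (subst bil_sym) auto

text \<open>Raising an index and lowering it again cancels. For invertible \<open>H\<close> this determines the
  product, and all its properties below follow from it.\<close>

lemma bil_raised_product:
  assumes "det H \<noteq> 0"
  shows "bil H (raised_product H A u v) z = tri A u v z"
proof -
  define c where "c = (\<chi> e. \<Sum>a\<in>UNIV. \<Sum>b\<in>UNIV. u $ a * v $ b * A $ a $ b $ e)"
  have "raised_product H A u v $ k = (c v* matrix_inv H) $ k" for k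
  proof -
    have "raised_product H A u v $ k = (\<Sum>a\<in>UNIV. \<Sum>b\<in>UNIV. \<Sum>e\<in>UNIV.
        u $ a * v $ b * A $ a $ b $ e * matrix_inv H $ e $ k)"
      by (simp add: raised_product_def sum_distrib_left mult.assoc)
    also have "\<dots> = (\<Sum>e\<in>UNIV. \<Sum>a\<in>UNIV. \<Sum>b\<in>UNIV.
        u $ a * v $ b * A $ a $ b $ e * matrix_inv H $ e $ k)"
      by (rule sum_rotate3)
    also have "\<dots> = (c v* matrix_inv H) $ k"
      by (simp add: c_def vector_matrix_mult_def sum_distrib_left mult_ac)
    finally show ?thesis .
  qed
  then have "raised_product H A u v = c v* matrix_inv H" by (simp add: vec_eq_iff)
  then have "bil H (raised_product H A u v) z = c \<bullet> z"
    using assms by (simp add: bil_inner dot_lmul_matrix matrix_vector_mul_assoc matrix_inv_cancel)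
  also have "\<dots> = (\<Sum>e\<in>UNIV. \<Sum>a\<in>UNIV. \<Sum>b\<in>UNIV. A $ a $ b $ e * u $ a * v $ b * z $ e)"
    by (simp add: c_def inner_vec_def sum_distrib_left sum_distrib_right mult_ac)
  also have "\<dots> = tri A u v z" unfolding tri_def by (rule sum_rotate3[symmetric])
  finally show ?thesis .
qed

text \<open>Both sides have the same values under \<open>bil H\<close> against every \<open>z = J z'\<close>, because the forms for \<open>H'\<close> and
  \<open>A'\<close> are the pullbacks along \<open>J\<close> of the forms for \<open>H\<close> and \<open>A\<close>.\<close>

lemma raised_product_natural:
  fixes J :: "real^'n^'n"
  assumes J: "invertible J" and H: "det H \<noteq> 0" "det H' \<noteq> 0"
    and H': "\<And>a b. H' $ a $ b = (\<Sum>i\<in>UNIV. \<Sum>j\<in>UNIV. J $ i $ a * J $ j $ b * H $ i $ j)"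
    and A': "\<And>a b e. A' $ a $ b $ e = (\<Sum>i\<in>UNIV. \<Sum>j\<in>UNIV. \<Sum>k\<in>UNIV.
      J $ i $ a * J $ j $ b * J $ k $ e * A $ i $ j $ k)"
  shows "raised_product H A (J *v u) (J *v v) = J *v raised_product H' A' u v"
proof (rule bil_nondegenerate[OF H(1)])
  fix z
  define z' where "z' = matrix_inv J *v z"
  have z: "z = J *v z'"
    using matrix_inv_cancel(1)[OF J[unfolded invertible_det_nz]]
    by (simp add: z'_def matrix_vector_mul_assoc)
  show "bil H (raised_product H A (J *v u) (J *v v)) z = bil H (J *v raised_product H' A' u v) z"
    by (simp add: z bil_raised_product[OF H(1)] bil_pullback[OF H', symmetric] tri_pullback[OF A', symmetric]
        bil_raised_product[OF H(2)])
qed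

lemma raised_product_add_left: "raised_product H A (u + u') v = raised_product H A u v + raised_product H A u' v"
  by (simp add: raised_product_def vec_eq_iff distrib_right sum.distrib)

lemma raised_product_add_right: "raised_product H A u (v + v') = raised_product H A u v + raised_product H A u v'"
  by (simp add: raised_product_def vec_eq_iff distrib_left distrib_right sum.distrib)

lemma raised_product_scale_left: "raised_product H A (r *\<^sub>R u) v = r *\<^sub>R raised_product H A u v"
  by (simp add: raised_product_def vec_eq_iff sum_distrib_left mult_ac)

lemma raised_product_scale_right: "raised_product H A u (r *\<^sub>R v) = r *\<^sub>R raised_product H A u v"
  by (simp add: raised_product_def vec_eq_iff sum_distrib_left mult_ac)

lemma matrix_vector_mult_eq_sum: "(J::real^'n^'m) *v w = (\<Sum>k\<in>UNIV. w $ k *\<^sub>R (J *v axis k 1))"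
  by (simp add: vec_eq_iff matrix_vector_mult_basis column_def) (simp add: matrix_vector_mult_def mult.commute)

lemma raised_product_axis:
  "raised_product H A (axis a 1) (axis b 1) = (\<chi> k. \<Sum>e\<in>UNIV. A $ a $ b $ e * matrix_inv H $ e $ k)"
proof -
  let ?F = "\<lambda>k a b. \<Sum>e\<in>UNIV. A $ a $ b $ e * matrix_inv H $ e $ k"
  have "(\<Sum>b'\<in>UNIV. axis a 1 $ a' * axis b 1 $ b' * ?F k a' b') = (if a' = a then ?F k a b else 0)" for a' k
  proof -
    have "axis a 1 $ a' * axis b 1 $ b' * ?F k a' b' = (if b' = b then if a' = a then ?F k a b else 0 else 0)" for b'
      by (simp add: axis_def)
    then show ?thesis by (simp only: sum.delta finite UNIV_I if_True)
  qed
  then show ?thesis by (simp only: raised_product_def sum.delta finite UNIV_I if_True)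
qed

section \<open>Second and third derivatives under affine maps and along vector fields\<close>

lemma partial_sum_scaleR:
  assumes "\<And>k. k \<in> K \<Longrightarrow> g k differentiable (at x)"
  shows "partial i (\<lambda>y. \<Sum>k\<in>K. c k *\<^sub>R g k y) x = (\<Sum>k\<in>K. c k *\<^sub>R partial i (g k) x)"
proof -
  have "((\<lambda>y. \<Sum>k\<in>K. c k *\<^sub>R g k y) has_derivative
      (\<lambda>v. \<Sum>k\<in>K. c k *\<^sub>R frechet_derivative (g k) (at x) v)) (at x)"
    using assms frechet_derivative_works
    by (intro has_derivative_sum has_derivative_scaleR_right) blast
  from partial_eqI[OF this, of i] show ?thesis by (simp add: partial_def)
qed

text \<open>An affine map has no second derivative, so the chain rule produces no term with first
  derivatives of \<open>g\<close>.\<close>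

lemma partial2_affine:
  fixes L :: "real^'n^'m" and g :: "real^'m \<Rightarrow> real"
  assumes N: "open N" and T: "open T" and aff: "\<And>y. y \<in> N \<Longrightarrow> L *v y + b \<in> T" and g: "smooth_on T g"
    and f: "\<And>y. y \<in> N \<Longrightarrow> f y = g (L *v y + b)" and x: "x \<in> N"
  shows "partial a (partial e f) x = (\<Sum>i\<in>UNIV. \<Sum>j\<in>UNIV. L $ i $ a * L $ j $ e * partial i (partial j g) (L *v x + b))"
proof -
  let ?G = "\<lambda>y. \<Sum>j\<in>UNIV. L $ j $ e *\<^sub>R partial j g y"
  have G: "smooth_on T ?G"
    by (intro smooth_on_sum smooth_on_scaleR smooth_on_const smooth_on_partial T g)
  have "partial e f y = ?G (L *v y + b)" if "y \<in> N" for y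
    by (rule partial_affine[where g = g, OF N that f smooth_on_differentiable[OF g aff[OF that]]])
  from partial_affine[where g = ?G, OF N x this smooth_on_differentiable[OF G aff[OF x]]]
  have "partial a (partial e f) x = (\<Sum>i\<in>UNIV. L $ i $ a *\<^sub>R partial i ?G (L *v x + b))" .
  moreover have "partial i ?G (L *v x + b) = (\<Sum>j\<in>UNIV. L $ j $ e *\<^sub>R partial i (partial j g) (L *v x + b))" for i
    by (rule partial_sum_scaleR) (rule smooth_on_differentiable[OF smooth_on_partial[OF g] aff[OF x]])
  ultimately show ?thesis by (simp add: sum_distrib_left mult_ac)
qed

lemma partial3_affine:
  fixes L :: "real^'n^'m" and g :: "real^'m \<Rightarrow> real"
  assumes N: "open N" and T: "open T" and aff: "\<And>y. y \<in> N \<Longrightarrow> L *v y + b \<in> T" and g: "smooth_on T g"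
    and f: "\<And>y. y \<in> N \<Longrightarrow> f y = g (L *v y + b)" and x: "x \<in> N"
  shows "partial a (partial c (partial e f)) x = (\<Sum>i\<in>UNIV. \<Sum>j\<in>UNIV. \<Sum>k\<in>UNIV.
    L $ i $ a * L $ j $ c * L $ k $ e * partial i (partial j (partial k g)) (L *v x + b))"
proof -
  let ?G = "\<lambda>y. \<Sum>k\<in>UNIV. L $ k $ e *\<^sub>R partial k g y"
  have G: "smooth_on T ?G"
    by (intro smooth_on_sum smooth_on_scaleR smooth_on_const smooth_on_partial T g)
  have "partial e f y = ?G (L *v y + b)" if "y \<in> N" for y
    by (rule partial_affine[where g = g, OF N that f smooth_on_differentiable[OF g aff[OF that]]])
  from partial2_affine[where g = ?G, OF N T aff G this x]
  have *: "partial a (partial c (partial e f)) x = (\<Sum>i\<in>UNIV. \<Sum>j\<in>UNIV. L $ i $ a * L $ j $ c *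
      partial i (partial j ?G) (L *v x + b))" .
  have 1: "partial j ?G y = (\<Sum>k\<in>UNIV. L $ k $ e *\<^sub>R partial j (partial k g) y)" if "y \<in> T" for j y
    by (rule partial_sum_scaleR) (rule smooth_on_differentiable[OF smooth_on_partial[OF g] that])
  have 2: "partial i (partial j ?G) (L *v x + b)
      = (\<Sum>k\<in>UNIV. L $ k $ e *\<^sub>R partial i (partial j (partial k g)) (L *v x + b))" for i j
  proof -
    have "partial i (partial j ?G) (L *v x + b)
        = partial i (\<lambda>y. \<Sum>k\<in>UNIV. L $ k $ e *\<^sub>R partial j (partial k g) y) (L *v x + b)"
      by (rule partial_cong_open[OF T aff[OF x] 1])
    also have "\<dots> = (\<Sum>k\<in>UNIV. L $ k $ e *\<^sub>R partial i (partial j (partial k g)) (L *v x + b))"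
      by (rule partial_sum_scaleR)
        (rule smooth_on_differentiable[OF smooth_on_partial[OF smooth_on_partial[OF g]] aff[OF x]])
    finally show ?thesis .
  qed
  show ?thesis unfolding * 2 by (simp add: sum_distrib_left mult_ac)
qed

text \<open>The second derivative \<open>\<partial>\<^sub>v \<partial>\<^sub>\<eta> \<zeta>\<close>, split into the part that differentiates the direction \<open>\<eta>\<close> and the
  part that is bilinear in \<open>v\<close> and \<open>\<eta>\<close>.\<close>

lemma frechet_derivative_directional:
  fixes \<eta> :: "real^'n \<Rightarrow> real^'n" and \<zeta> :: "real^'n \<Rightarrow> real^'m"
  assumes V: "open V" "x \<in> V" and \<eta>: "smooth_on V \<eta>" and \<zeta>: "smooth_on V \<zeta>"
  shows "frechet_derivative (\<lambda>y. frechet_derivative \<zeta> (at y) (\<eta> y)) (at x) v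
    = frechet_derivative \<zeta> (at x) (frechet_derivative \<eta> (at x) v)
      + (\<Sum>i\<in>UNIV. \<Sum>j\<in>UNIV. (v $ i * \<eta> x $ j) *\<^sub>R partial i (partial j \<zeta>) x)"
proof -
  have d\<eta>: "(\<eta> has_derivative frechet_derivative \<eta> (at x)) (at x)"
    using smooth_on_differentiable[OF \<eta> V(2)] frechet_derivative_works by blast
  have d\<zeta>: "(partial j \<zeta> has_derivative frechet_derivative (partial j \<zeta>) (at x)) (at x)" for j
    using smooth_on_differentiable[OF smooth_on_partial[OF \<zeta>] V(2)] frechet_derivative_works by blast
  have "frechet_derivative (\<lambda>y. frechet_derivative \<zeta> (at y) (\<eta> y)) (at x)
      = frechet_derivative (\<lambda>y. \<Sum>j\<in>UNIV. \<eta> y $ j *\<^sub>R partial j \<zeta> y) (at x)"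
    by (rule frechet_derivative_cong_open[OF V])
      (rule frechet_derivative_eq_sum_partial[OF smooth_on_differentiable[OF \<zeta>]])
  moreover have D: "((\<lambda>y. \<Sum>j\<in>UNIV. \<eta> y $ j *\<^sub>R partial j \<zeta> y) has_derivative
      (\<lambda>v. \<Sum>j\<in>UNIV. \<eta> x $ j *\<^sub>R frechet_derivative (partial j \<zeta>) (at x) v
        + frechet_derivative \<eta> (at x) v $ j *\<^sub>R partial j \<zeta> x)) (at x)"
    by (intro has_derivative_sum has_derivative_scaleR d\<zeta>
        bounded_linear.has_derivative[OF bounded_linear_vec_nth] d\<eta>)
  ultimately have "frechet_derivative (\<lambda>y. frechet_derivative \<zeta> (at y) (\<eta> y)) (at x) v
      = (\<Sum>j\<in>UNIV. \<eta> x $ j *\<^sub>R frechet_derivative (partial j \<zeta>) (at x) v)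
        + (\<Sum>j\<in>UNIV. frechet_derivative \<eta> (at x) v $ j *\<^sub>R partial j \<zeta> x)"
    using frechet_derivative_at[OF D, symmetric] by (simp add: sum.distrib)
  moreover have "(\<Sum>j\<in>UNIV. \<eta> x $ j *\<^sub>R frechet_derivative (partial j \<zeta>) (at x) v)
      = (\<Sum>j\<in>UNIV. \<Sum>i\<in>UNIV. (v $ i * \<eta> x $ j) *\<^sub>R partial i (partial j \<zeta>) x)"
    by (simp add: frechet_derivative_eq_sum_partial[OF smooth_on_differentiable[OF smooth_on_partial[OF \<zeta>] V(2)]]
        scaleR_sum_right mult.commute)
  moreover have "(\<Sum>j\<in>UNIV. \<Sum>i\<in>UNIV. (v $ i * \<eta> x $ j) *\<^sub>R partial i (partial j \<zeta>) x)
      = (\<Sum>i\<in>UNIV. \<Sum>j\<in>UNIV. (v $ i * \<eta> x $ j) *\<^sub>R partial i (partial j \<zeta>) x)"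
    by (rule sum.swap)
  ultimately show ?thesis
    by (simp add: frechet_derivative_eq_sum_partial[OF smooth_on_differentiable[OF \<zeta> V(2)]])
qed

text \<open>The bilinear parts cancel because mixed partial derivatives commute. This is the vanishing of the curvature
  in coordinates.\<close>

lemma second_directional_commute:
  fixes \<xi> \<eta> :: "real^'n \<Rightarrow> real^'n" and \<zeta> :: "real^'n \<Rightarrow> real^'m"
  assumes V: "open V" "x \<in> V" and \<xi>: "smooth_on V \<xi>" and \<eta>: "smooth_on V \<eta>" and \<zeta>: "smooth_on V \<zeta>"
  shows "frechet_derivative (\<lambda>y. frechet_derivative \<zeta> (at y) (\<eta> y)) (at x) (\<xi> x)
     - frechet_derivative (\<lambda>y. frechet_derivative \<zeta> (at y) (\<xi> y)) (at x) (\<eta> x)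
     = frechet_derivative \<zeta> (at x) (frechet_derivative \<eta> (at x) (\<xi> x) - frechet_derivative \<xi> (at x) (\<eta> x))"
proof -
  have "(\<Sum>i\<in>UNIV. \<Sum>j\<in>UNIV. (\<xi> x $ i * \<eta> x $ j) *\<^sub>R partial i (partial j \<zeta>) x)
      = (\<Sum>i\<in>UNIV. \<Sum>j\<in>UNIV. (\<xi> x $ j * \<eta> x $ i) *\<^sub>R partial j (partial i \<zeta>) x)"
    by (rule sum.swap)
  also have "\<dots> = (\<Sum>i\<in>UNIV. \<Sum>j\<in>UNIV. (\<eta> x $ i * \<xi> x $ j) *\<^sub>R partial i (partial j \<zeta>) x)"
    by (intro sum.cong refl)
      (simp only: smooth_on_partial_commute[OF V(1) \<zeta> V(2)] mult.commute)
  finally show ?thesis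
    by (simp add: frechet_derivative_directional[OF V \<eta> \<zeta>] frechet_derivative_directional[OF V \<xi> \<zeta>]
        linear_diff[OF linear_frechet_derivative[OF smooth_on_differentiable[OF \<zeta> V(2)]]])
qed

lemma frechet_derivative_bil:
  fixes G :: "real^'m \<Rightarrow> real^'n^'n" and \<eta> \<zeta> :: "real^'m \<Rightarrow> real^'n"
  assumes G: "G differentiable (at x)" and \<eta>: "\<eta> differentiable (at x)" and \<zeta>: "\<zeta> differentiable (at x)"
  shows "frechet_derivative (\<lambda>y. bil (G y) (\<eta> y) (\<zeta> y)) (at x) v
    = bil (frechet_derivative G (at x) v) (\<eta> x) (\<zeta> x)
      + bil (G x) (frechet_derivative \<eta> (at x) v) (\<zeta> x)
      + bil (G x) (\<eta> x) (frechet_derivative \<zeta> (at x) v)"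
proof -
  let ?G = "frechet_derivative G (at x)" and ?\<eta> = "frechet_derivative \<eta> (at x)"
    and ?\<zeta> = "frechet_derivative \<zeta> (at x)"
  note D = G[unfolded frechet_derivative_works] \<eta>[unfolded frechet_derivative_works] \<zeta>[unfolded frechet_derivative_works]
  note nth = bounded_linear.has_derivative[OF bounded_linear_vec_nth]
  have "((\<lambda>y. bil (G y) (\<eta> y) (\<zeta> y)) has_derivative (\<lambda>v. \<Sum>i\<in>UNIV. \<Sum>j\<in>UNIV.
      (G x $ i $ j * \<eta> x $ i) * ?\<zeta> v $ j + (G x $ i $ j * ?\<eta> v $ i + ?G v $ i $ j * \<eta> x $ i) * \<zeta> x $ j)) (at x)"
    unfolding bil_def
    by (intro has_derivative_sum has_derivative_mult nth[OF nth[OF D(1)]] nth[OF D(2)] nth[OF D(3)])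
  from frechet_derivative_at[OF this, symmetric] show ?thesis
    by (simp add: bil_def sum.distrib algebra_simps)
qed

section \<open>Flat charts and their transition maps\<close>

lemma is_chart_inj:
  assumes "is_chart T c"
  shows "inj_on (coord c) (chart_dom c)"
proof -
  have "homeomorphic_map (subtopology T (chart_dom c)) (top_of_set (coord c ` chart_dom c)) (coord c)"
    "chart_dom c \<subseteq> topspace T"
    using assms openin_subset by (auto simp: is_chart_def)
  then show ?thesis
    using homeomorphic_imp_injective_map by (fastforce simp: Int_absorb1)
qed

lemma is_chart_open_image:
  assumes c: "is_chart T c" and U: "openin T U"
  shows "open (coord c ` (U \<inter> chart_dom c))"
proof -
  have "openin (subtopology T (chart_dom c)) (U \<inter> chart_dom c)"
    using U by (auto simp: openin_subtopology)
  moreover have "open_map (subtopology T (chart_dom c)) (top_of_set (coord c ` chart_dom c)) (coord c)"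
    using c by (auto simp: is_chart_def intro: homeomorphic_imp_open_map)
  ultimately have "openin (top_of_set (coord c ` chart_dom c)) (coord c ` (U \<inter> chart_dom c))"
    by (simp add: open_map_def)
  then show ?thesis using c openin_open_trans by (auto simp: is_chart_def)
qed

lemma local_rep_coord:
  assumes "is_chart T c" "p \<in> chart_dom c"
  shows "local_rep c F (coord c p) = F p"
  using inv_into_f_f[OF is_chart_inj[OF assms(1)] assms(2)] by (simp add: local_rep_def)

lemma jacobian_eqI:
  fixes f :: "real^'n \<Rightarrow> real^'m"
  assumes "(f has_derivative (\<lambda>v. L *v v)) (at x)"
  shows "jacobian f (at x) = L"
  using frechet_derivative_at[OF assms, symmetric] by (simp add: jacobian_def)

lemma affinely_compatibleE:
  assumes "affinely_compatible T c d" "p \<in> chart_dom c \<inter> chart_dom d"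
  obtains W L b where "openin T W" "p \<in> W" "W \<subseteq> chart_dom c \<inter> chart_dom d" "invertible L"
    "\<And>q. q \<in> W \<Longrightarrow> coord d q = L *v coord c q + b"
proof -
  have "\<exists>W L b. openin T W \<and> p \<in> W \<and> W \<subseteq> chart_dom c \<inter> chart_dom d \<and>
      invertible L \<and> (\<forall>q\<in>W. coord d q = L *v coord c q + b)"
    by (rule bspec[OF assms(1)[unfolded affinely_compatible_def] assms(2)])
  then obtain W L b where *: "openin T W \<and> p \<in> W \<and> W \<subseteq> chart_dom c \<inter> chart_dom d \<and>
      invertible L \<and> (\<forall>q\<in>W. coord d q = L *v coord c q + b)"
    by (elim exE)
  show thesis by (rule that[of W L b]) (use * in auto)
qed

locale flat_manifold =
  fixes M :: "('a, 'n::finite) affine_structure"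
  assumes mfd: "affine_manifold M"
begin

lemma flat_chartD: "c \<in> flat_charts M \<Longrightarrow> is_chart (mtop M) c"
  by (simp add: flat_charts_def)

lemma matlas_flat: "matlas M \<subseteq> flat_charts M"
  using mfd by (auto simp: affine_manifold_def flat_charts_def)

lemma chart_dom_open: "c \<in> flat_charts M \<Longrightarrow> openin (mtop M) (chart_dom c)"
  using flat_chartD by (auto simp: is_chart_def)

lemma chart_dom_topspace: "c \<in> flat_charts M \<Longrightarrow> topspace (mtop M) \<inter> chart_dom c = chart_dom c"
  using chart_dom_open openin_subset by blast

lemma open_image: "c \<in> flat_charts M \<Longrightarrow> openin (mtop M) U \<Longrightarrow> open (coord c ` (U \<inter> chart_dom c))"
  using flat_chartD is_chart_open_image by blast

lemma open_image_dom: "c \<in> flat_charts M \<Longrightarrow> open (coord c ` chart_dom c)"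
  using flat_chartD by (auto simp: is_chart_def)

lemma rep_coord: "c \<in> flat_charts M \<Longrightarrow> p \<in> chart_dom c \<Longrightarrow> local_rep c F (coord c p) = F p"
  by (rule local_rep_coord[OF flat_chartD])

lemma atlas_chart_at:
  assumes "c \<in> flat_charts M" "p \<in> chart_dom c"
  obtains e where "e \<in> matlas M" "p \<in> chart_dom e"
  using assms mfd chart_dom_topspace unfolding affine_manifold_def by blast

text \<open>Both charts are affinely related to a chart of the atlas around \<open>p\<close>, and affine changes of coordinates can be
  inverted and composed.\<close>

lemma affinely_compatible_flat:
  assumes c: "c \<in> flat_charts M" and d: "d \<in> flat_charts M"
  shows "affinely_compatible (mtop M) c d"
  unfolding affinely_compatible_def
proof
  fix p assume p: "p \<in> chart_dom c \<inter> chart_dom d"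
  obtain e where e: "e \<in> matlas M" "p \<in> chart_dom e"
    using atlas_chart_at[OF c] p by blast
  have "affinely_compatible (mtop M) c e" using c e by (simp add: flat_charts_def)
  then obtain W1 L1 b1 where 1: "openin (mtop M) W1" "p \<in> W1" "W1 \<subseteq> chart_dom c \<inter> chart_dom e"
      "invertible L1" "\<And>q. q \<in> W1 \<Longrightarrow> coord e q = L1 *v coord c q + b1"
    by (rule affinely_compatibleE[of _ _ _ p]) (use p e in auto)
  have "affinely_compatible (mtop M) d e" using d e by (simp add: flat_charts_def)
  then obtain W2 L2 b2 where 2: "openin (mtop M) W2" "p \<in> W2" "W2 \<subseteq> chart_dom d \<inter> chart_dom e"
      "invertible L2" "\<And>q. q \<in> W2 \<Longrightarrow> coord e q = L2 *v coord d q + b2"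
    by (rule affinely_compatibleE[of _ _ _ p]) (use p e in auto)
  obtain K where K: "L2 ** K = mat 1" "K ** L2 = mat 1"
    using 2(4) unfolding invertible_def by blast
  have inv: "invertible (K ** L1)"
    using 1(4) K by (intro invertible_mult) (auto simp: invertible_def)
  have "coord d q = (K ** L1) *v coord c q + K *v (b1 - b2)" if "q \<in> W1 \<inter> W2" for q
  proof -
    have "L2 *v coord d q = L1 *v coord c q + (b1 - b2)"
      using 1(5)[of q] 2(5)[of q] that by (simp add: algebra_simps)
    then have "K *v (L2 *v coord d q) = K *v (L1 *v coord c q + (b1 - b2))" by simp
    then show ?thesis
      by (simp only: matrix_vector_mul_assoc K matrix_vector_mul_lid matrix_vector_right_distrib)
  qed
  then show "\<exists>W L b. openin (mtop M) W \<and> p \<in> W \<and> W \<subseteq> chart_dom c \<inter> chart_dom d \<and>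
        invertible L \<and> (\<forall>q\<in>W. coord d q = L *v coord c q + b)"
    using 1 2 inv by (intro exI[of _ "W1 \<inter> W2"] exI[of _ "K ** L1"] exI[of _ "K *v (b1 - b2)"]) auto
qed

lemma local_rep_affine:
  assumes c: "c \<in> flat_charts M" and d: "d \<in> flat_charts M" and W: "W \<subseteq> chart_dom c \<inter> chart_dom d"
    and aff: "\<And>q. q \<in> W \<Longrightarrow> coord d q = L *v coord c q + b" and x: "x \<in> coord c ` W"
  shows "local_rep c F x = local_rep d F (L *v x + b)"
proof -
  from x obtain q where q: "q \<in> W" "x = coord c q" by blast
  then have "local_rep c F x = F q" "local_rep d F (coord d q) = F q"
    using rep_coord[OF c, of q F] rep_coord[OF d, of q F] W by auto
  then show ?thesis using aff[OF q(1)] q(2) by simp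
qed

text \<open>The form in which transition maps are used: near \<open>p\<close>, and inside any prescribed open set, the
  transition map is affine and its Jacobian is constant.\<close>

lemma transition:
  assumes c: "c \<in> flat_charts M" and d: "d \<in> flat_charts M"
    and U: "openin (mtop M) U" and p: "p \<in> U \<inter> chart_dom c \<inter> chart_dom d"
  obtains W L b where "openin (mtop M) W" "p \<in> W" "W \<subseteq> U \<inter> chart_dom c \<inter> chart_dom d" "invertible L"
    "\<And>q. q \<in> W \<Longrightarrow> coord d q = L *v coord c q + b"
    "\<And>q. q \<in> W \<Longrightarrow> transition_jacobian c d q = L"
    "open (coord c ` W)"
proof -
  obtain W0 L b where W0: "openin (mtop M) W0" "p \<in> W0" "W0 \<subseteq> chart_dom c \<inter> chart_dom d"
      "invertible L" "\<And>q. q \<in> W0 \<Longrightarrow> coord d q = L *v coord c q + b"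
    by (rule affinely_compatibleE[OF affinely_compatible_flat[OF c d], of p]) (use p in auto)
  define W where "W = W0 \<inter> U"
  have W: "openin (mtop M) W" "p \<in> W" "W \<subseteq> U \<inter> chart_dom c \<inter> chart_dom d"
    using W0 U p by (auto simp: W_def)
  have aff: "coord d q = L *v coord c q + b" if "q \<in> W" for q using W0 that by (simp add: W_def)
  have "W \<inter> chart_dom c = W" using W by blast
  then have N: "open (coord c ` W)" using open_image[OF c W(1)] by simp
  have J: "transition_jacobian c d q = L" if q: "q \<in> W" for q
    unfolding transition_jacobian_def
  proof (rule jacobian_eqI, rule has_derivative_transform_within_open[OF has_derivative_affine N])
    show "coord c q \<in> coord c ` W" using q by blast
    fix x assume "x \<in> coord c ` W"
    then obtain r where r: "r \<in> W" "x = coord c r" by blast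
    then show "L *v x + b = local_rep c (coord d) x"
      using rep_coord[OF c, of r "coord d"] W(3) aff by auto
  qed
  show thesis using that[OF W W0(4) aff J N] .
qed

lemma transition_jacobian_invertible:
  assumes "c \<in> flat_charts M" "d \<in> flat_charts M" "p \<in> chart_dom c \<inter> chart_dom d"
  shows "invertible (transition_jacobian c d p)"
proof -
  have "p \<in> chart_dom c \<inter> chart_dom c \<inter> chart_dom d" using assms(3) by blast
  then show ?thesis
    by (rule transition[OF assms(1,2) chart_dom_open[OF assms(1)]]) simp
qed

section \<open>Vector fields and the flat connection\<close>

lemma vf_smooth:
  "vector_field_on M U X \<Longrightarrow> c \<in> flat_charts M \<Longrightarrow> smooth_on (coord c ` (U \<inter> chart_dom c)) (local_rep c (X c))"
  by (simp add: vector_field_on_def smooth_in_charts_def)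

lemma vf_differentiable:
  "vector_field_on M U X \<Longrightarrow> c \<in> flat_charts M \<Longrightarrow> p \<in> U \<inter> chart_dom c \<Longrightarrow>
    local_rep c (X c) differentiable (at (coord c p))"
  by (rule smooth_on_differentiable[OF vf_smooth]) auto

lemma vf_transform:
  "vector_field_on M U X \<Longrightarrow> c \<in> flat_charts M \<Longrightarrow> d \<in> flat_charts M \<Longrightarrow>
    p \<in> U \<inter> chart_dom c \<inter> chart_dom d \<Longrightarrow> X d p = transition_jacobian c d p *v X c p"
  unfolding vector_field_on_def by blast

lemma rep_flat_connection:
  assumes "x \<in> coord c ` (U \<inter> chart_dom c)"
  shows "local_rep c (flat_connection X Y c) x
     = frechet_derivative (local_rep c (Y c)) (at x) (local_rep c (X c) x)"
proof -
  have "coord c (inv_into (chart_dom c) (coord c) x) = x" using assms by (intro f_inv_into_f) auto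
  then show ?thesis by (simp add: local_rep_def flat_connection_def dir_deriv_def)
qed

lemma dir_deriv_cong:
  assumes c: "c \<in> flat_charts M" and U: "openin (mtop M) U" and p: "p \<in> U \<inter> chart_dom c"
    and F: "\<And>q. q \<in> U \<inter> chart_dom c \<Longrightarrow> F q = G q" and X: "X c p = X' c p"
  shows "dir_deriv c X F p = dir_deriv c X' G p"
proof -
  have eq: "local_rep c F x = local_rep c G x" if x: "x \<in> coord c ` (U \<inter> chart_dom c)" for x
  proof -
    obtain q where "q \<in> U \<inter> chart_dom c" "x = coord c q" using x by blast
    then show ?thesis using F[of q] rep_coord[OF c, of q F] rep_coord[OF c, of q G] by simp
  qed
  have "coord c p \<in> coord c ` (U \<inter> chart_dom c)" using p by blast
  from frechet_derivative_cong_open[where f = "local_rep c F" and g = "local_rep c G", OF open_image[OF c U] this eq]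
  have "frechet_derivative (local_rep c F) (at (coord c p)) = frechet_derivative (local_rep c G) (at (coord c p))" .
  then show ?thesis by (simp add: dir_deriv_def X)
qed

text \<open>Since the Jacobian is constant near \<open>p\<close>, the identity \<open>Y d = L (Y c)\<close> can be differentiated
  without differentiating \<open>L\<close>.\<close>

lemma flat_connection_vector_field:
  assumes U: "openin (mtop M) U" and X: "vector_field_on M U X" and Y: "vector_field_on M U Y"
  shows "vector_field_on M U (flat_connection X Y)"
  unfolding vector_field_on_def smooth_in_charts_def
proof (intro conjI ballI)
  fix c assume c: "c \<in> flat_charts M"
  let ?V = "coord c ` (U \<inter> chart_dom c)"
  have V: "open ?V" using open_image[OF c U] .
  have sm: "smooth_on ?V (\<lambda>x. \<Sum>i\<in>UNIV. local_rep c (X c) x $ i *\<^sub>R partial i (local_rep c (Y c)) x)"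
    by (intro smooth_on_sum smooth_on_scaleR smooth_on_vec_nth smooth_on_partial V vf_smooth[OF X c] vf_smooth[OF Y c])
  show "smooth_on ?V (local_rep c (flat_connection X Y c))"
  proof (rule smooth_on_cong[OF V _ sm])
    fix x assume x: "x \<in> ?V"
    show "(\<Sum>i\<in>UNIV. local_rep c (X c) x $ i *\<^sub>R partial i (local_rep c (Y c)) x) = local_rep c (flat_connection X Y c) x"
      using frechet_derivative_eq_sum_partial[OF smooth_on_differentiable[OF vf_smooth[OF Y c] x]]
      by (simp add: rep_flat_connection[OF x])
  qed
next
  fix c d p assume c: "c \<in> flat_charts M" and d: "d \<in> flat_charts M" and p: "p \<in> U \<inter> chart_dom c \<inter> chart_dom d"
  obtain W L b where W: "openin (mtop M) W" "p \<in> W" "W \<subseteq> U \<inter> chart_dom c \<inter> chart_dom d"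
      and "invertible L" and W': "\<And>q. q \<in> W \<Longrightarrow> coord d q = L *v coord c q + b"
      "\<And>q. q \<in> W \<Longrightarrow> transition_jacobian c d q = L" "open (coord c ` W)"
    by (rule transition[OF c d U p]) (rule that)
  let ?x = "coord c p" and ?\<psi> = "local_rep c (Y c)" and ?\<phi> = "local_rep d (Y d)"
  have x: "?x \<in> coord c ` W" using W(2) by blast
  have dx: "coord d p = L *v ?x + b" using W'(1) W(2) by blast
  have \<psi>: "(?\<psi> has_derivative frechet_derivative ?\<psi> (at ?x)) (at ?x)"
    using vf_differentiable[OF Y c] p frechet_derivative_works by blast
  have \<phi>: "?\<phi> differentiable (at (L *v ?x + b))"
    using vf_differentiable[OF Y d, of p] p dx by auto
  have eq: "L *v ?\<psi> y = ?\<phi> (L *v y + b)" if "y \<in> coord c ` W" for y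
  proof -
    from that obtain q where q: "q \<in> W" "y = coord c q" by blast
    have qU: "q \<in> U \<inter> chart_dom c \<inter> chart_dom d" using W(3) q(1) by blast
    from vf_transform[OF Y c d qU] W'(2)[OF q(1)] have "L *v Y c q = Y d q" by simp
    then show ?thesis
      using rep_coord[OF c, of q "Y c"] rep_coord[OF d, of q "Y d"] qU W'(1)[OF q(1)] q(2) by simp
  qed
  have "((\<lambda>y. L *v ?\<psi> y) has_derivative (\<lambda>v. frechet_derivative ?\<phi> (at (L *v ?x + b)) (L *v v))) (at ?x)"
    by (rule has_derivative_compose_affine[where g = ?\<phi>, OF W'(3) x eq \<phi>])
  moreover have "((\<lambda>y. L *v ?\<psi> y) has_derivative (\<lambda>v. L *v frechet_derivative ?\<psi> (at ?x) v)) (at ?x)"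
    by (rule bounded_linear.has_derivative[OF matrix_vector_mul_bounded_linear \<psi>])
  ultimately have "frechet_derivative ?\<phi> (at (L *v ?x + b)) (L *v v) = L *v frechet_derivative ?\<psi> (at ?x) v" for v
    by (metis has_derivative_unique)
  moreover have "X d p = L *v X c p" using vf_transform[OF X c d p] W(2) W'(2) by simp
  ultimately show "flat_connection X Y d p = transition_jacobian c d p *v flat_connection X Y c p"
    using W(2) W'(2) dx by (simp add: flat_connection_def dir_deriv_def)
qed

lemma dir_deriv_add_field:
  assumes "local_rep c F differentiable (at (coord c p))"
  shows "dir_deriv c (field_add X X') F p = dir_deriv c X F p + dir_deriv c X' F p"
  by (simp add: dir_deriv_def linear_add[OF linear_frechet_derivative[OF assms]])

lemma dir_deriv_scale_field:
  assumes "local_rep c F differentiable (at (coord c p))"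
  shows "dir_deriv c (field_scale f X) F p = f p *\<^sub>R dir_deriv c X F p"
  by (simp add: dir_deriv_def linear_cmul[OF linear_frechet_derivative[OF assms]])

lemma dir_deriv_add:
  assumes "local_rep c F differentiable (at (coord c p))" "local_rep c G differentiable (at (coord c p))"
  shows "dir_deriv c X (\<lambda>q. F q + G q) p = dir_deriv c X F p + dir_deriv c X G p"
proof -
  have "(local_rep c (\<lambda>q. F q + G q) has_derivative
      (\<lambda>v. frechet_derivative (local_rep c F) (at (coord c p)) v + frechet_derivative (local_rep c G) (at (coord c p)) v))
      (at (coord c p))"
    using has_derivative_add[OF assms[unfolded frechet_derivative_works]] by (simp add: local_rep_def)
  from frechet_derivative_at[OF this, symmetric] show ?thesis by (simp add: dir_deriv_def)
qed

lemma dir_deriv_scale: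
  assumes c: "c \<in> flat_charts M" "p \<in> chart_dom c"
    and "local_rep c f differentiable (at (coord c p))" "local_rep c G differentiable (at (coord c p))"
  shows "dir_deriv c X (\<lambda>q. f q *\<^sub>R G q) p = dir_deriv c X f p *\<^sub>R G p + f p *\<^sub>R dir_deriv c X G p"
proof -
  let ?x = "coord c p"
  have "((\<lambda>x. local_rep c f x *\<^sub>R local_rep c G x) has_derivative
      (\<lambda>v. local_rep c f ?x *\<^sub>R frechet_derivative (local_rep c G) (at ?x) v
        + frechet_derivative (local_rep c f) (at ?x) v *\<^sub>R local_rep c G ?x)) (at ?x)"
    using assms(3,4) by (intro has_derivative_scaleR) (simp_all add: frechet_derivative_works)
  then have "(local_rep c (\<lambda>q. f q *\<^sub>R G q) has_derivative
      (\<lambda>v. local_rep c f ?x *\<^sub>R frechet_derivative (local_rep c G) (at ?x) v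
        + frechet_derivative (local_rep c f) (at ?x) v *\<^sub>R local_rep c G ?x)) (at ?x)"
    by (simp add: local_rep_def)
  from frechet_derivative_at[OF this, symmetric] show ?thesis
    by (simp add: dir_deriv_def rep_coord[OF c] add.commute)
qed

lemma smooth_fun_differentiable:
  "smooth_fun M U f \<Longrightarrow> c \<in> flat_charts M \<Longrightarrow> p \<in> U \<inter> chart_dom c \<Longrightarrow>
    local_rep c f differentiable (at (coord c p))"
  unfolding smooth_fun_def smooth_in_charts_def
  by (rule smooth_on_differentiable[of "coord c ` (U \<inter> chart_dom c)"]) auto

lemma flat_connection_is_connection: "connection_on M flat_connection"
  unfolding connection_on_def
proof (intro allI impI, elim conjE, intro conjI allI impI)
  fix U and X Y :: "('a, 'n) vfield"
  assume U: "openin (mtop M) U" and X: "vector_field_on M U X" and Y: "vector_field_on M U Y"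
  note dY = vf_differentiable[OF Y]
  show "vector_field_on M U (flat_connection X Y)"
    by (rule flat_connection_vector_field[OF U X Y])
  show "eq_field_on M U (flat_connection X Y) (flat_connection X' Y')"
    if "vector_field_on M U X' \<and> vector_field_on M U Y' \<and> eq_field_on M U X X' \<and> eq_field_on M U Y Y'"
    for X' Y' :: "('a, 'n) vfield"
    unfolding eq_field_on_def flat_connection_def
    using that by (intro ballI dir_deriv_cong[OF _ U]) (auto simp: eq_field_on_def)
  show "eq_field_on M U (flat_connection (field_add X X') Y) (field_add (flat_connection X Y) (flat_connection X' Y))"
    for X' :: "('a, 'n) vfield"
    unfolding eq_field_on_def flat_connection_def by (intro ballI dir_deriv_add_field dY)
  show "eq_field_on M U (flat_connection X (field_add Y Y')) (field_add (flat_connection X Y) (flat_connection X Y'))"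
    if "vector_field_on M U Y'" for Y' :: "('a, 'n) vfield"
    unfolding eq_field_on_def flat_connection_def by (intro ballI dir_deriv_add dY vf_differentiable[OF that])
  fix f :: "'a \<Rightarrow> real" assume f: "smooth_fun M U f"
  show "eq_field_on M U (flat_connection (field_scale f X) Y) (field_scale f (flat_connection X Y))"
    unfolding eq_field_on_def flat_connection_def by (intro ballI dir_deriv_scale_field dY)
  show "eq_field_on M U (flat_connection X (field_scale f Y))
      (\<lambda>c p. dir_deriv c X f p *\<^sub>R Y c p + f p *\<^sub>R flat_connection X Y c p)"
    unfolding eq_field_on_def flat_connection_def
    by (intro ballI dir_deriv_scale dY smooth_fun_differentiable[OF f]) auto
qed

lemma flat_connection_torsion_free: "torsion_free M flat_connection"
  by (simp add: torsion_free_def eq_field_on_def flat_connection_def lie_bracket_def)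

lemma flat_connection_curvature_free: "curvature_free M flat_connection"
  unfolding curvature_free_def eq_field_on_def
proof (intro allI impI ballI, elim conjE)
  fix U and X Y Z :: "('a, 'n) vfield" and c p
  assume U: "openin (mtop M) U" and X: "vector_field_on M U X" and Y: "vector_field_on M U Y"
    and Z: "vector_field_on M U Z" and c: "c \<in> flat_charts M" and p: "p \<in> U \<inter> chart_dom c"
  let ?V = "coord c ` (U \<inter> chart_dom c)" and ?x = "coord c p" and ?\<zeta> = "local_rep c (Z c)"
  have V: "open ?V" "?x \<in> ?V" using open_image[OF c U] p by auto
  \<comment> \<open>The representative of a derived field is known only on the image of the chart, an open set.\<close>
  have D: "frechet_derivative (local_rep c (flat_connection Q Z c)) (at ?x)
      = frechet_derivative (\<lambda>y. frechet_derivative ?\<zeta> (at y) (local_rep c (Q c) y)) (at ?x)" for Q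
    by (rule frechet_derivative_cong_open[OF V]) (rule rep_flat_connection)
  have rep: "local_rep c (Q c) ?x = Q c p" for Q :: "('a, 'n) vfield" using rep_coord[OF c] p by blast
  have fc: "flat_connection Q R c p = frechet_derivative (local_rep c (R c)) (at ?x) (Q c p)" for Q R :: "('a, 'n) vfield"
    by (simp add: flat_connection_def dir_deriv_def)
  show "field_diff (field_diff (flat_connection X (flat_connection Y Z)) (flat_connection Y (flat_connection X Z)))
      (flat_connection (lie_bracket X Y) Z) c p = 0"
    using second_directional_commute[OF V vf_smooth[OF X c] vf_smooth[OF Y c] vf_smooth[OF Z c]]
    by (simp only: fc D lie_bracket_def dir_deriv_def rep) simp
qed

text \<open>A coordinate field has locally constant components in every flat chart.\<close>

lemma coord_field_parallel:
  assumes c: "c \<in> flat_charts M"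
  shows "eq_field_on M (chart_dom c) (flat_connection X (coord_field c a)) field_zero"
  unfolding eq_field_on_def
proof (intro ballI)
  fix d p assume d: "d \<in> flat_charts M" and p: "p \<in> chart_dom c \<inter> chart_dom d"
  from p have "p \<in> chart_dom c \<inter> chart_dom c \<inter> chart_dom d" by blast
  then obtain W L where W: "openin (mtop M) W" "p \<in> W" "W \<subseteq> chart_dom d"
      "\<And>q. q \<in> W \<Longrightarrow> transition_jacobian c d q = L"
    by (rule transition[OF c d chart_dom_open[OF c]]) auto
  have "dir_deriv d X (coord_field c a d) p = dir_deriv d X (\<lambda>q. L *v axis a 1) p"
    by (rule dir_deriv_cong[OF d W(1)]) (use W in \<open>auto simp: coord_field_def\<close>)
  also have "\<dots> = 0" by (simp add: dir_deriv_def local_rep_def)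
  finally show "flat_connection X (coord_field c a) d p = 0" by (simp add: flat_connection_def)
qed

lemma flat_connection_affine_flat: "affine_flat_connection M flat_connection"
  unfolding affine_flat_connection_def
  using flat_connection_is_connection flat_connection_torsion_free flat_connection_curvature_free
    coord_field_parallel by blast

end

section \<open>The metric, the cubic tensor and the product of a potential\<close>

text \<open>The hypotheses common to both cases: in flat charts the potential is smooth with a nondegenerate
  Hessian.\<close>

locale hessian_manifold = flat_manifold M for M :: "('a, 'n::finite) affine_structure" +
  fixes \<Psi> :: "'a \<Rightarrow> real"
  assumes smooth_rep: "c \<in> flat_charts M \<Longrightarrow> smooth_on (coord c ` chart_dom c) (local_rep c \<Psi>)"
    and nondegenerate_rep: "c \<in> flat_charts M \<Longrightarrow> p \<in> chart_dom c \<Longrightarrow>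
      det (hessian (local_rep c \<Psi>) (coord c p)) \<noteq> 0"
begin

abbreviation g :: "('a, 'n) tensor2" where "g \<equiv> hessian_metric \<Psi>"
abbreviation A :: "('a, 'n) tensor3" where "A \<equiv> third_derivative_tensor \<Psi>"

lemma g_eq_hessian: "g c p = hessian (local_rep c \<Psi>) (coord c p)"
  by (simp add: hessian_metric_def hessian_def)

lemma det_g: "c \<in> flat_charts M \<Longrightarrow> p \<in> chart_dom c \<Longrightarrow> det (g c p) \<noteq> 0"
  by (simp add: g_eq_hessian nondegenerate_rep)

lemma coord_inv_into: "x \<in> coord c ` chart_dom c \<Longrightarrow> coord c (inv_into (chart_dom c) (coord c) x) = x"
  by (rule f_inv_into_f)

lemma rep_g: "x \<in> coord c ` chart_dom c \<Longrightarrow> local_rep c (g c) x = hessian (local_rep c \<Psi>) x"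
  unfolding local_rep_def[of c "g c"] by (simp only: g_eq_hessian coord_inv_into)

lemma smooth_hessian: "c \<in> flat_charts M \<Longrightarrow> smooth_on (coord c ` chart_dom c) (hessian (local_rep c \<Psi>))"
  unfolding hessian_def
  by (intro smooth_on_vec_lambda smooth_on_partial smooth_rep open_image_dom)

lemma smooth_rep_g:
  assumes c: "c \<in> flat_charts M"
  shows "smooth_on (coord c ` chart_dom c) (local_rep c (g c))"
  by (rule smooth_on_cong[OF open_image_dom[OF c] rep_g[symmetric] smooth_hessian[OF c]])

lemma smooth_rep_A:
  assumes c: "c \<in> flat_charts M"
  shows "smooth_on (coord c ` chart_dom c) (local_rep c (A c))"
proof (rule smooth_on_cong[OF open_image_dom[OF c]])
  show "smooth_on (coord c ` chart_dom c)
      (\<lambda>x. \<chi> i j k. partial i (partial j (partial k (local_rep c \<Psi>))) x)"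
    by (intro smooth_on_vec_lambda smooth_on_partial smooth_rep open_image_dom c)
  show "(\<chi> i j k. partial i (partial j (partial k (local_rep c \<Psi>))) x) = local_rep c (A c) x"
    if "x \<in> coord c ` chart_dom c" for x
    unfolding local_rep_def[of c "A c"] by (simp only: third_derivative_tensor_def coord_inv_into[OF that])
qed

text \<open>The representatives of the potential in two flat charts differ by composition with the affine
  transition map; the chain rules above then give the tensor laws for \<open>g\<close> and \<open>A\<close>.\<close>

lemma potential_transition:
  assumes c: "c \<in> flat_charts M" and d: "d \<in> flat_charts M" and p: "p \<in> chart_dom c \<inter> chart_dom d"
  obtains N b where "open N" "coord c p \<in> N"
    "coord d p = transition_jacobian c d p *v coord c p + b"
    "\<And>y. y \<in> N \<Longrightarrow> transition_jacobian c d p *v y + b \<in> coord d ` chart_dom d"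
    "\<And>y. y \<in> N \<Longrightarrow> local_rep c \<Psi> y = local_rep d \<Psi> (transition_jacobian c d p *v y + b)"
proof -
  from p have "p \<in> chart_dom c \<inter> chart_dom c \<inter> chart_dom d" by blast
  then obtain W L b where W: "p \<in> W" "W \<subseteq> chart_dom c \<inter> chart_dom d"
    and aff: "\<And>q. q \<in> W \<Longrightarrow> coord d q = L *v coord c q + b"
    and J: "\<And>q. q \<in> W \<Longrightarrow> transition_jacobian c d q = L" and N: "open (coord c ` W)"
    by (rule transition[OF c d chart_dom_open[OF c]]) auto
  show thesis
  proof (rule that[OF N, of b])
    show "coord c p \<in> coord c ` W" using W by blast
    show "coord d p = transition_jacobian c d p *v coord c p + b" using aff J W by simp
    fix y assume y: "y \<in> coord c ` W"
    then obtain q where q: "q \<in> W" "y = coord c q" by blast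
    have "coord d q \<in> coord d ` chart_dom d" using q(1) W(2) by blast
    then show "transition_jacobian c d p *v y + b \<in> coord d ` chart_dom d"
      by (simp add: J[OF W(1)] q(2) aff[OF q(1), symmetric])
    show "local_rep c \<Psi> y = local_rep d \<Psi> (transition_jacobian c d p *v y + b)"
      unfolding J[OF W(1)] by (rule local_rep_affine[OF c d W(2) aff y])
  qed
qed

lemma g_transform:
  assumes c: "c \<in> flat_charts M" and d: "d \<in> flat_charts M" and p: "p \<in> chart_dom c \<inter> chart_dom d"
  shows "g c p $ a $ b = (\<Sum>i\<in>UNIV. \<Sum>j\<in>UNIV.
    transition_jacobian c d p $ i $ a * transition_jacobian c d p $ j $ b * g d p $ i $ j)"
proof -
  obtain N b' where N: "open N" "coord c p \<in> N"
    and eq: "coord d p = transition_jacobian c d p *v coord c p + b'"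
    and aff: "\<And>y. y \<in> N \<Longrightarrow> transition_jacobian c d p *v y + b' \<in> coord d ` chart_dom d"
    and rep: "\<And>y. y \<in> N \<Longrightarrow> local_rep c \<Psi> y = local_rep d \<Psi> (transition_jacobian c d p *v y + b')"
    by (rule potential_transition[OF c d p]) (rule that)
  from partial2_affine[OF N(1) open_image_dom[OF d] aff smooth_rep[OF d] rep N(2), of a b]
  show ?thesis by (simp add: hessian_metric_def eq)
qed

lemma A_transform:
  assumes c: "c \<in> flat_charts M" and d: "d \<in> flat_charts M" and p: "p \<in> chart_dom c \<inter> chart_dom d"
  shows "A c p $ a $ b $ e = (\<Sum>i\<in>UNIV. \<Sum>j\<in>UNIV. \<Sum>k\<in>UNIV.
    transition_jacobian c d p $ i $ a * transition_jacobian c d p $ j $ b * transition_jacobian c d p $ k $ e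
      * A d p $ i $ j $ k)"
proof -
  obtain N b' where N: "open N" "coord c p \<in> N"
    and eq: "coord d p = transition_jacobian c d p *v coord c p + b'"
    and aff: "\<And>y. y \<in> N \<Longrightarrow> transition_jacobian c d p *v y + b' \<in> coord d ` chart_dom d"
    and rep: "\<And>y. y \<in> N \<Longrightarrow> local_rep c \<Psi> y = local_rep d \<Psi> (transition_jacobian c d p *v y + b')"
    by (rule potential_transition[OF c d p]) (rule that)
  from partial3_affine[OF N(1) open_image_dom[OF d] aff smooth_rep[OF d] rep N(2), of a b e]
  show ?thesis by (simp add: third_derivative_tensor_def eq)
qed

lemma tensor2_g: "tensor2_on_manifold M g"
  unfolding tensor2_on_manifold_def smooth_in_charts_def
  by (intro conjI ballI allI g_transform) (simp_all add: chart_dom_topspace smooth_rep_g)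

lemma tensor3_A: "tensor3_on_manifold M A"
  unfolding tensor3_on_manifold_def smooth_in_charts_def
  by (intro conjI ballI allI A_transform) (simp_all add: chart_dom_topspace smooth_rep_A)

lemma g_sym:
  assumes c: "c \<in> flat_charts M" and p: "p \<in> chart_dom c"
  shows "g c p $ a $ b = g c p $ b $ a"
  using smooth_on_partial_commute_real[OF open_image_dom[OF c] smooth_rep[OF c], of "coord c p" a b] p
  by (simp add: hessian_metric_def)

lemma A_sym12:
  assumes c: "c \<in> flat_charts M" and p: "p \<in> chart_dom c"
  shows "A c p $ a $ b $ e = A c p $ b $ a $ e"
  using smooth_on_partial_commute_real[OF open_image_dom[OF c] smooth_on_partial[OF smooth_rep[OF c]], of "coord c p" a b e] p
  by (simp add: third_derivative_tensor_def)

lemma A_sym23: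
  assumes c: "c \<in> flat_charts M" and p: "p \<in> chart_dom c"
  shows "A c p $ a $ b $ e = A c p $ a $ e $ b"
proof -
  have x: "coord c p \<in> coord c ` chart_dom c" using p by blast
  have "partial a (partial b (partial e (local_rep c \<Psi>))) (coord c p)
      = partial a (partial e (partial b (local_rep c \<Psi>))) (coord c p)"
    by (rule partial_cong_open[OF open_image_dom[OF c] x])
      (rule smooth_on_partial_commute_real[OF open_image_dom[OF c] smooth_rep[OF c]])
  then show ?thesis by (simp add: third_derivative_tensor_def)
qed

lemma g_nondegenerate: "nondegenerate_tensor2 M g"
  unfolding nondegenerate_tensor2_def
proof (intro ballI allI impI)
  fix c p and u :: "real^'n"
  assume c: "c \<in> flat_charts M" and p: "p \<in> chart_dom c"
    and 0: "\<forall>v. (\<Sum>i\<in>UNIV. \<Sum>j\<in>UNIV. g c p $ i $ j * u $ i * v $ j) = 0"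
  show "u = 0"
    by (rule bil_nondegenerate[OF det_g[OF c p]]) (use 0 in \<open>simp add: bil_def\<close>)
qed

lemma A_eq_partial_hessian:
  assumes c: "c \<in> flat_charts M" and p: "p \<in> chart_dom c"
  shows "A c p $ k = partial k (hessian (local_rep c \<Psi>)) (coord c p)"
proof -
  let ?H = "hessian (local_rep c \<Psi>)" and ?x = "coord c p"
  have x: "?x \<in> coord c ` chart_dom c" using p by blast
  have H: "?H differentiable (at ?x)" by (rule smooth_on_differentiable[OF smooth_hessian[OF c] x])
  have Hi: "(\<lambda>x. ?H x $ i) differentiable (at ?x)" for i
    by (rule smooth_on_differentiable[OF smooth_on_vec_nth[OF open_image_dom[OF c] smooth_hessian[OF c]] x])
  have "partial k ?H ?x $ i $ j = A c p $ k $ i $ j" for i j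
    using partial_vec_nth[OF Hi, of k i j] partial_vec_nth[OF H, of k i]
    by (simp add: third_derivative_tensor_def hessian_def)
  then show ?thesis by (simp add: vec_eq_iff)
qed

lemma tensor2_eval_bil: "tensor2_eval h X Y c p = bil (h c p) (X c p) (Y c p)"
  by (simp add: tensor2_eval_def bil_def)

lemma tensor3_eval_tri: "tensor3_eval B X Y Z c p = tri (B c p) (X c p) (Y c p) (Z c p)"
  by (simp add: tensor3_eval_def tri_def)

text \<open>The product rule for \<open>g(Y, Z)\<close> has three terms; the two in which \<open>Y\<close> or \<open>Z\<close> is differentiated are
  those subtracted in the covariant derivative. What remains is the derivative of the Hessian along \<open>X\<close>.\<close>

lemma cov_deriv_g_eq_A:
  assumes U: "openin (mtop M) U" and Y: "vector_field_on M U Y" and Z: "vector_field_on M U Z"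
    and c: "c \<in> flat_charts M" and p: "p \<in> U \<inter> chart_dom c"
  shows "cov_deriv2 flat_connection g X Y Z c p = tri (A c p) (X c p) (Y c p) (Z c p)"
proof -
  let ?V = "coord c ` (U \<inter> chart_dom c)" and ?x = "coord c p" and ?H = "hessian (local_rep c \<Psi>)"
  let ?\<eta> = "local_rep c (Y c)" and ?\<zeta> = "local_rep c (Z c)"
  have V: "open ?V" "?x \<in> ?V" using open_image[OF c U] p by auto
  have pc: "p \<in> chart_dom c" and x: "?x \<in> coord c ` chart_dom c" using p by auto
  have H: "?H differentiable (at ?x)" by (rule smooth_on_differentiable[OF smooth_hessian[OF c] x])
  have "frechet_derivative (local_rep c (tensor2_eval g Y Z c)) (at ?x)
      = frechet_derivative (\<lambda>y. bil (?H y) (?\<eta> y) (?\<zeta> y)) (at ?x)"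
  proof (rule frechet_derivative_cong_open[OF V])
    fix y assume "y \<in> ?V"
    then have "y \<in> coord c ` chart_dom c" by blast
    then show "local_rep c (tensor2_eval g Y Z c) y = bil (?H y) (?\<eta> y) (?\<zeta> y)"
      by (simp only: rep_g[symmetric]) (simp add: local_rep_def tensor2_eval_bil)
  qed
  then have "dir_deriv c X (tensor2_eval g Y Z c) p = bil (frechet_derivative ?H (at ?x) (X c p)) (Y c p) (Z c p)
      + bil (g c p) (flat_connection X Y c p) (Z c p) + bil (g c p) (Y c p) (flat_connection X Z c p)"
    by (simp add: dir_deriv_def frechet_derivative_bil[OF H vf_differentiable[OF Y c p] vf_differentiable[OF Z c p]]
        g_eq_hessian flat_connection_def rep_coord[OF c pc])
  then have "cov_deriv2 flat_connection g X Y Z c p = bil (frechet_derivative ?H (at ?x) (X c p)) (Y c p) (Z c p)"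
    by (simp add: cov_deriv2_def tensor2_eval_bil)
  also have "\<dots> = bil (\<Sum>k\<in>UNIV. X c p $ k *\<^sub>R A c p $ k) (Y c p) (Z c p)"
    by (simp only: frechet_derivative_eq_sum_partial[OF H] A_eq_partial_hessian[OF c pc])
  also have "\<dots> = (\<Sum>i\<in>UNIV. \<Sum>j\<in>UNIV. \<Sum>k\<in>UNIV. X c p $ k * A c p $ k $ i $ j * Y c p $ i * Z c p $ j)"
    by (simp add: bil_def sum_distrib_right)
  also have "\<dots> = (\<Sum>k\<in>UNIV. \<Sum>i\<in>UNIV. \<Sum>j\<in>UNIV. X c p $ k * A c p $ k $ i $ j * Y c p $ i * Z c p $ j)"
    by (rule sum_rotate3)
  also have "\<dots> = tri (A c p) (X c p) (Y c p) (Z c p)"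
    by (simp add: tri_def mult_ac)
  finally show ?thesis .
qed

lemma cov_deriv_g_symmetric: "cov_deriv_symmetric M flat_connection g"
  unfolding cov_deriv_symmetric_def
proof (intro allI impI ballI, elim conjE)
  fix U and X Y Z :: "('a, 'n) vfield" and c p
  assume U: "openin (mtop M) U" and X: "vector_field_on M U X" and Y: "vector_field_on M U Y"
    and Z: "vector_field_on M U Z" and c: "c \<in> flat_charts M" and p: "p \<in> U \<inter> chart_dom c"
  have pc: "p \<in> chart_dom c" using p by blast
  show "cov_deriv2 flat_connection g X Y Z c p = cov_deriv2 flat_connection g Y X Z c p \<and>
      cov_deriv2 flat_connection g X Y Z c p = cov_deriv2 flat_connection g X Z Y c p"
    unfolding cov_deriv_g_eq_A[OF U Y Z c p] cov_deriv_g_eq_A[OF U X Z c p] cov_deriv_g_eq_A[OF U Z Y c p]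
    using tri_sym12[OF A_sym12[OF c pc]] tri_sym23[OF A_sym23[OF c pc]] by blast
qed

lemma field_mult_eq: "field_mult g A X Y c p = raised_product (g c p) (A c p) (X c p) (Y c p)"
  by (simp add: field_mult_def raised_product_def structure_const_def)

lemma field_mult_transform:
  assumes c: "c \<in> flat_charts M" and d: "d \<in> flat_charts M" and p: "p \<in> chart_dom c \<inter> chart_dom d"
  shows "raised_product (g d p) (A d p) (transition_jacobian c d p *v u) (transition_jacobian c d p *v v)
    = transition_jacobian c d p *v raised_product (g c p) (A c p) u v"
  using p by (intro raised_product_natural transition_jacobian_invertible[OF c d p] det_g c d
      g_transform[OF c d p] A_transform[OF c d p]) auto

lemma field_raised_producttor_field:
  assumes U: "openin (mtop M) U" and X: "vector_field_on M U X" and Y: "vector_field_on M U Y"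
  shows "vector_field_on M U (field_mult g A X Y)"
  unfolding vector_field_on_def smooth_in_charts_def
proof (intro conjI ballI)
  fix c assume c: "c \<in> flat_charts M"
  let ?V = "coord c ` (U \<inter> chart_dom c)"
  let ?G = "local_rep c (g c)" and ?A = "local_rep c (A c)"
    and ?\<xi> = "local_rep c (X c)" and ?\<eta> = "local_rep c (Y c)"
  have V: "open ?V" "?V \<subseteq> coord c ` chart_dom c" using open_image[OF c U] by auto
  have G: "smooth_on ?V ?G" by (rule smooth_on_subset[OF smooth_rep_g[OF c] V(2)])
  have A: "smooth_on ?V (\<lambda>x. ?A x $ a $ b $ e)" for a b e
    by (intro smooth_on_vec_nth V(1) smooth_on_subset[OF smooth_rep_A[OF c] V(2)])
  have \<xi>: "smooth_on ?V (\<lambda>x. ?\<xi> x $ a)" for a by (rule smooth_on_vec_nth[OF V(1) vf_smooth[OF X c]])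
  have \<eta>: "smooth_on ?V (\<lambda>x. ?\<eta> x $ a)" for a by (rule smooth_on_vec_nth[OF V(1) vf_smooth[OF Y c]])
  have det: "det (?G x) \<noteq> 0" if "x \<in> ?V" for x
  proof -
    from that obtain q where q: "q \<in> chart_dom c" "x = coord c q" by blast
    then show ?thesis using det_g[OF c q(1)] rep_coord[OF c q(1), of "g c"] by simp
  qed
  have I: "smooth_on ?V (\<lambda>x. matrix_inv (?G x) $ e $ k)" for e k
    by (rule smooth_on_matrix_inv[OF V(1) G det])
  have "smooth_on ?V (\<lambda>x. raised_product (?G x) (?A x) (?\<xi> x) (?\<eta> x))"
    unfolding raised_product_def
    by (intro smooth_on_vec_lambda smooth_on_sum smooth_on_mult A I \<xi> \<eta> V(1))
  moreover have "local_rep c (field_mult g A X Y c) = (\<lambda>x. raised_product (?G x) (?A x) (?\<xi> x) (?\<eta> x))"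
    by (simp add: local_rep_def field_mult_eq)
  ultimately show "smooth_on ?V (local_rep c (field_mult g A X Y c))" by simp
next
  fix c d p assume c: "c \<in> flat_charts M" and d: "d \<in> flat_charts M" and p: "p \<in> U \<inter> chart_dom c \<inter> chart_dom d"
  have p': "p \<in> chart_dom c \<inter> chart_dom d" using p by blast
  show "field_mult g A X Y d p = transition_jacobian c d p *v field_mult g A X Y c p"
    unfolding field_mult_eq vf_transform[OF X c d p] vf_transform[OF Y c d p]
    by (rule field_mult_transform[OF c d p'])
qed

lemma field_mult_bilinear: "bilinear_multiplication M (field_mult g A)"
  unfolding bilinear_multiplication_def
  by (auto simp: field_raised_producttor_field eq_field_on_def field_mult_eq raised_product_add_left raised_product_add_right
      raised_product_scale_left raised_product_scale_right)

text \<open>In its own chart a coordinate field is a standard basis vector, for which the product has the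
  structure constants as components; naturality carries this to every other flat chart.\<close>

lemma field_mult_structure_constants: "has_structure_constants M g A (field_mult g A)"
  unfolding has_structure_constants_def eq_field_on_def
proof (intro ballI allI)
  fix c d p a b
  assume c: "c \<in> flat_charts M" and d: "d \<in> flat_charts M" and p: "p \<in> chart_dom c \<inter> chart_dom d"
  have "field_mult g A (coord_field c a) (coord_field c b) d p
      = transition_jacobian c d p *v raised_product (g c p) (A c p) (axis a 1) (axis b 1)"
    by (simp only: field_mult_eq coord_field_def field_mult_transform[OF c d p])
  also have "raised_product (g c p) (A c p) (axis a 1) (axis b 1) = (\<chi> k. structure_const g A c p a b k)"
    by (simp add: raised_product_axis structure_const_def)
  also have "transition_jacobian c d p *v \<dots> = (\<Sum>k\<in>UNIV. structure_const g A c p a b k *\<^sub>R coord_field c k d p)"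
    by (subst matrix_vector_mult_eq_sum) (simp add: coord_field_def)
  finally show "field_mult g A (coord_field c a) (coord_field c b) d p
      = (\<Sum>k\<in>UNIV. structure_const g A c p a b k *\<^sub>R coord_field c k d p)" .
qed

text \<open>All three expressions are values of the symmetric form \<open>A\<close> on the same three vectors.\<close>

lemma field_mult_compatible: "mult_compatible M flat_connection g A (field_mult g A)"
  unfolding mult_compatible_def
proof (intro allI impI ballI)
  fix U and X Y Z :: "('a, 'n) vfield" and c p
  assume c: "c \<in> flat_charts M" and "p \<in> U \<inter> chart_dom c"
  then have p: "p \<in> chart_dom c" by blast
  let ?H = "g c p" and ?A = "A c p" and ?x = "X c p" and ?y = "Y c p" and ?z = "Z c p"
  note s12 = tri_sym12[OF A_sym12[OF c p]] and s23 = tri_sym23[OF A_sym23[OF c p]]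
  have "bil ?H ?x (raised_product ?H ?A ?y ?z) = tri ?A ?y ?z ?x"
    using bil_sym[OF g_sym[OF c p]] bil_raised_product[OF det_g[OF c p]] by metis
  also have "\<dots> = tri ?A ?x ?y ?z" using s12 s23 by metis
  finally show "tensor3_eval A X Y Z c p = tensor2_eval g (field_mult g A X Y) Z c p \<and>
      tensor2_eval g (field_mult g A X Y) Z c p = tensor2_eval g X (field_mult g A Y Z) c p"
    by (simp add: tensor2_eval_bil tensor3_eval_tri field_mult_eq bil_raised_product[OF det_g[OF c p]])
qed

theorem potential_pre_Frobenius: "potential_pre_Frobenius_manifold M \<Psi> g A flat_connection"
proof -
  have "symmetric_tensor2 M g" using g_sym by (simp add: symmetric_tensor2_def)
  moreover have "symmetric_tensor3 M A"
    unfolding symmetric_tensor3_def using A_sym12 A_sym23 by blast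
  moreover have "has_potential M A \<Psi>"
    by (simp add: has_potential_def smooth_fun_def smooth_in_charts_def chart_dom_topspace smooth_rep
        third_derivative_tensor_def)
  ultimately show ?thesis
    unfolding potential_pre_Frobenius_manifold_def
    using mfd flat_connection_affine_flat tensor2_g g_nondegenerate cov_deriv_g_symmetric tensor3_A
      field_mult_bilinear field_mult_structure_constants field_mult_compatible by blast
qed

end

section \<open>Domains and manifolds\<close>

text \<open>Around each point a flat chart is affinely related to a chart of the atlas, and there the Hessians
  are congruent by the invertible linear part.\<close>

lemma (in flat_manifold) hessian_manifold_from_atlas:
  assumes smooth: "\<And>e. e \<in> matlas M \<Longrightarrow> smooth_on (coord e ` chart_dom e) (local_rep e \<Psi>)"
    and det: "\<And>e x. e \<in> matlas M \<Longrightarrow> x \<in> coord e ` chart_dom e \<Longrightarrow> det (hessian (local_rep e \<Psi>) x) \<noteq> 0"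
  shows "hessian_manifold M \<Psi>"
proof
  have loc: "\<exists>N. open N \<and> coord c p \<in> N \<and> smooth_on N (local_rep c \<Psi>) \<and>
      det (hessian (local_rep c \<Psi>) (coord c p)) \<noteq> 0"
    if c: "c \<in> flat_charts M" and p: "p \<in> chart_dom c" for c p
  proof -
    obtain e where e: "e \<in> matlas M" "p \<in> chart_dom e" using atlas_chart_at[OF c p] .
    have ef: "e \<in> flat_charts M" using e matlas_flat by blast
    have "p \<in> chart_dom c \<inter> chart_dom c \<inter> chart_dom e" using p e by blast
    then obtain W L b where W: "p \<in> W" "W \<subseteq> chart_dom c \<inter> chart_dom e" and L: "invertible L"
      and aff: "\<And>q. q \<in> W \<Longrightarrow> coord e q = L *v coord c q + b" and N: "open (coord c ` W)"
      by (rule transition[OF c ef chart_dom_open[OF c]]) auto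
    have x: "coord c p \<in> coord c ` W" using W by blast
    have img: "L *v y + b \<in> coord e ` chart_dom e" if "y \<in> coord c ` W" for y
    proof -
      from that obtain q where q: "q \<in> W" "y = coord c q" by blast
      have "coord e q \<in> coord e ` chart_dom e" using q(1) W(2) by blast
      then show ?thesis by (simp add: q(2) aff[OF q(1), symmetric])
    qed
    have rep: "local_rep c \<Psi> y = local_rep e \<Psi> (L *v y + b)" if "y \<in> coord c ` W" for y
      by (rule local_rep_affine[OF c ef W(2) aff that])
    have "smooth_on (coord c ` W) (local_rep c \<Psi>)"
      by (rule smooth_on_affine[OF N img smooth[OF e(1)] rep])
    moreover have "hessian (local_rep c \<Psi>) (coord c p)
        = transpose L ** hessian (local_rep e \<Psi>) (L *v coord c p + b) ** L"
      using partial2_affine[OF N open_image_dom[OF ef] img smooth[OF e(1)] rep x]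
      by (simp add: vec_eq_iff congruence_nth) (simp add: hessian_def)
    then have "det (hessian (local_rep c \<Psi>) (coord c p)) \<noteq> 0"
      using det[OF e(1) img[OF x]] L by (simp add: det_mul det_transpose invertible_det_nz)
    ultimately show ?thesis using N x by blast
  qed
  fix c assume c: "c \<in> flat_charts M"
  show "smooth_on (coord c ` chart_dom c) (local_rep c \<Psi>)"
    by (rule smooth_on_local) (use loc[OF c] in blast)
  show "det (hessian (local_rep c \<Psi>) (coord c p)) \<noteq> 0" if "p \<in> chart_dom c" for p
    using loc[OF c that] by blast
qed

lemma standard_affine_manifold:
  fixes D :: "(real^'n) set"
  assumes "open D"
  shows "affine_manifold (standard_affine D)"
proof -
  have "is_chart (top_of_set D) (D, \<lambda>x. x)"
    using assms by (auto simp: is_chart_def homeomorphic_map_id[unfolded id_def] subtopology_subtopology)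
  moreover have "affinely_compatible (top_of_set D) (D, \<lambda>x. x) (D, \<lambda>x. x)"
    unfolding affinely_compatible_def
    by (intro ballI exI[of _ D] exI[of _ "mat 1"] exI[of _ 0]) (auto simp: invertible_def)
  moreover have "second_countable (euclidean :: (real^'n) topology)"
  proof -
    obtain B :: "(real^'n) set set" where B: "countable B" "topological_basis B"
      using ex_countable_basis by blast
    have "\<exists>V\<in>B. x \<in> V \<and> V \<subseteq> U" if "open U" "x \<in> U" for U x
      using topological_basisE[OF B(2) that] by metis
    then show ?thesis
      using B(1) topological_basis_open[OF B(2)]
      unfolding second_countable_def open_openin[symmetric] by blast
  qed
  then have "second_countable (top_of_set D)" by (rule second_countable_subtopology)
  moreover have "Hausdorff_space (top_of_set D)"
    by (simp add: Hausdorff_space_subtopology Hausdorff_space_euclidean)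
  ultimately show ?thesis by (simp add: affine_manifold_def standard_affine_def)
qed

theorem proposition2p4p1:
  fixes D :: "(real^'n) set" and \<Psi> :: "real^'n \<Rightarrow> real"
    and M :: "('a, 'm::finite) affine_structure" and \<Phi> :: "'a \<Rightarrow> real"
  shows "(GEMA D \<Psi> \<longrightarrow>
            potential_pre_Frobenius_domain (standard_affine D) \<Psi>
              (hessian_metric \<Psi>) (third_derivative_tensor \<Psi>) flat_connection) \<and>
         (Monge_Ampere_manifold M \<Phi> \<longrightarrow>
            potential_pre_Frobenius_manifold M \<Phi>
              (hessian_metric \<Phi>) (third_derivative_tensor \<Phi>) flat_connection)"
proof (intro conjI impI)
  assume G: "GEMA D \<Psi>"
  then have D: "is_domain D" "open D" and sm: "smooth_on D \<Psi>"
    and det: "\<And>x. x \<in> D \<Longrightarrow> det (hessian \<Psi> x) \<noteq> 0"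
    by (auto simp: GEMA_def is_domain_def monge_ampere_potential_def)
  interpret flat_manifold "standard_affine D"
    by unfold_locales (rule standard_affine_manifold[OF D(2)])
  let ?c = "(D, \<lambda>x. x) :: (real^'n, 'n) chart"
  have rep: "\<Psi> x = local_rep ?c \<Psi> x" if "x \<in> D" for x
    using inv_into_f_f[of "\<lambda>x. x" D x] that by (simp add: local_rep_def)
  have "hessian (local_rep ?c \<Psi>) x = hessian \<Psi> x" if x: "x \<in> D" for x
  proof -
    have "partial i (partial j \<Psi>) x = partial i (partial j (local_rep ?c \<Psi>)) x" for i j
      by (intro partial_cong_open[OF D(2)] rep x)
    then show ?thesis by (simp add: hessian_def)
  qed
  then have "hessian_manifold (standard_affine D) \<Psi>"
    using smooth_on_cong[OF D(2) rep sm] det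
    by (intro hessian_manifold_from_atlas) (auto simp: standard_affine_def)
  then have "potential_pre_Frobenius_manifold (standard_affine D) \<Psi>
      (hessian_metric \<Psi>) (third_derivative_tensor \<Psi>) flat_connection"
    by (rule hessian_manifold.potential_pre_Frobenius)
  then show "potential_pre_Frobenius_domain (standard_affine D) \<Psi>
      (hessian_metric \<Psi>) (third_derivative_tensor \<Psi>) flat_connection"
    unfolding potential_pre_Frobenius_domain_def using D(1) by (auto simp: standard_affine_def)
next
  assume MA: "Monge_Ampere_manifold M \<Phi>"
  then have pot: "monge_ampere_potential (coord c ` chart_dom c) (local_rep c \<Phi>)" if "c \<in> flat_charts M" for c
    using that by (simp add: Monge_Ampere_manifold_def)
  have "hessian_manifold M \<Phi>"
  proof
    show "affine_manifold M" using MA by (simp add: Monge_Ampere_manifold_def)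
    fix c assume c: "c \<in> flat_charts M"
    show "smooth_on (coord c ` chart_dom c) (local_rep c \<Phi>)"
      using pot[OF c] by (simp add: monge_ampere_potential_def)
    show "det (hessian (local_rep c \<Phi>) (coord c p)) \<noteq> 0" if "p \<in> chart_dom c" for p
      using pot[OF c] that by (auto simp: monge_ampere_potential_def)
  qed
  then show "potential_pre_Frobenius_manifold M \<Phi>
      (hessian_metric \<Phi>) (third_derivative_tensor \<Phi>) flat_connection"
    by (rule hessian_manifold.potential_pre_Frobenius)
qed

end
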